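(* Let an algorithm take as input $n$ candidate answers sampled from an LLM $L$ for a query $x$. Assume: (i) the equivalence, implication, and incompatibility primitives are implemented via pairwise checks; and (ii) the chosen incompatibility score $\mathtt{InS}(\cdot)$ can be computed on any directed graph with $k$ vertices in $\mathcal{O}(k^2)$ time. Then computing $\mathtt{LGU}(x\mid L)=(1+\mathtt{InS}(x\mid L))\,\mathtt{IGE}(x\mid L)$ takes $\mathcal{O}(n^2)$ time in the worst case, and this bound is tight.
   Context: Answers and relations. Fix a query $x$. There is a set of possible situations compatible with $x$, and each answer is either true or false in each such situation. Answer $a$ implies answer $b$ (w.r.t. $x$) if $b$ is true in every situation compatible with $x$ in which $a$ is true; $a\equiv b$ (equivalent) if each implies the other; $a$ and $b$ are incompatible if there is no situation compatible with $x$ in which both are true. Equivalent clusters are the equivalence classes of the finite set of sampled answers under $\equiv$. Implication and incompatibility between clusters are defined via any representatives. Cost model. The relations between answers are accessed only through pairwise checks (does $a\equiv b$? does $a$ imply $b$? are $a,b$ incompatible?), each counted as one unit of time, as is each arithmetic operation (including logarithms). The cluster probabilities are obtained from probabilities (or empirical frequencies) of the sampled answers. Tightness means that in the worst case $\Omega(n^2)$ time (pairwise checks) is required. Graphs. All graphs are directed without self-loops. The implication graph $\mathrm{ImG}(x\mid L)$ has the equivalent clusters $c_1,\dots,c_t$ as vertices, with probabilities $p_1,\dots,p_t$ (nonnegative, summing to 1), and an edge $(c_s,c_u)$ for distinct clusters iff $c_s$ implies $c_u$. A root is a vertex with in-degree $0$; $\mathcal{R}=\{r_1,\dots,r_k\}$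 denotes the set of roots. The incompatibility graph $\mathrm{InG}(x\mid L)$ has vertex set $\mathcal{R}$ and contains both $(c_s,c_u)$ and $(c_u,c_s)$ whenever $c_s\ne c_u$ are incompatible roots. Measures. For a root $r_i$ let $\mathrm{Reach}(r_i)$ be the set of vertices of $\mathrm{ImG}(x\mid L)$ reachable from $r_i$ (including $r_i$), $p'(r_i)=\sum_{c_j\in\mathrm{Reach}(r_i)}p_j$, and $p(r_i)=p'(r_i)/\sum_{j=1}^k p'(r_j)$. The Implication Graph Entropy is $\mathtt{IGE}(x\mid L)=-\sum_{i=1}^k p(r_i)\log p(r_i)$. An incompatibility score $\mathtt{InS}(x\mid L)\ge 0$ is a numerical function of the graph $\mathrm{InG}(x\mid L)$ (for example its directed edge density). The Logical Graph Uncertainty is $\mathtt{LGU}(x\mid L)=(1+\mathtt{InS}(x\mid L))\,\mathtt{IGE}(x\mid L)$. *)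

theory Defs
  imports Complex_Main "HOL-Library.Landau_Symbols" "Graph_Theory.Pair_Digraph"
begin

section \<open>Sampled answers and their logical relations\<close>

text \<open>
  A sample for a fixed query: the situations compatible with the query, the truth of answers in
  situations, and the list of the \<open>n\<close> sampled answers with their probabilities. An answer may be
  listed several times; its occurrences then add up, so that empirical frequencies are the special
  case in which every weight is \<open>1 / n\<close>.
\<close>

record ('a, 's) sample =
  situations :: "'s set"
  holds :: "'a \<Rightarrow> 's \<Rightarrow> bool"
  answers :: "'a list"
  weights :: "real list"

definition num_answers :: "('a, 's) sample \<Rightarrow> nat" where
  "num_answers I = length (answers I)"

definition valid_sample :: "('a, 's) sample \<Rightarrow> bool" where
  "valid_sample I \<longleftrightarrow>
     length (weights I) = length (answers I) \<and> (\<forall>w \<in> set (weights I). 0 \<le> w) \<and>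
     sum_list (weights I) = 1"

definition implies :: "('a, 's) sample \<Rightarrow> 'a \<Rightarrow> 'a \<Rightarrow> bool" where
  "implies I a b \<longleftrightarrow> (\<forall>s \<in> situations I. holds I a s \<longrightarrow> holds I b s)"

definition equivalent :: "('a, 's) sample \<Rightarrow> 'a \<Rightarrow> 'a \<Rightarrow> bool" where
  "equivalent I a b \<longleftrightarrow> implies I a b \<and> implies I b a"

definition incompatible :: "('a, 's) sample \<Rightarrow> 'a \<Rightarrow> 'a \<Rightarrow> bool" where
  "incompatible I a b \<longleftrightarrow> \<not> (\<exists>s \<in> situations I. holds I a s \<and> holds I b s)"

definition equiv_rel :: "('a, 's) sample \<Rightarrow> ('a \<times> 'a) set" where
  "equiv_rel I = {(a, b). a \<in> set (answers I) \<and> b \<in> set (answers I) \<and> equivalent I a b}"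

definition clusters :: "('a, 's) sample \<Rightarrow> 'a set set" where
  "clusters I = set (answers I) // equiv_rel I"

definition cluster_prob :: "('a, 's) sample \<Rightarrow> 'a set \<Rightarrow> real" where
  "cluster_prob I c = (\<Sum>i | i < num_answers I \<and> answers I ! i \<in> c. weights I ! i)"

text \<open>The choice of representatives is immaterial; see \<open>cluster_implies_iff\<close> and
  \<open>cluster_incompatible_iff\<close> below.\<close>

definition cluster_implies :: "('a, 's) sample \<Rightarrow> 'a set \<Rightarrow> 'a set \<Rightarrow> bool" where
  "cluster_implies I c d \<longleftrightarrow> (\<exists>a \<in> c. \<exists>b \<in> d. implies I a b)"

definition cluster_incompatible :: "('a, 's) sample \<Rightarrow> 'a set \<Rightarrow> 'a set \<Rightarrow> bool" where
  "cluster_incompatible I c d \<longleftrightarrow> (\<exists>a \<in> c. \<exists>b \<in> d. incompatible I a b)"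

lemma implies_refl: "implies I a a"
  by (simp add: implies_def)

lemma implies_trans:
  assumes "implies I a b" "implies I b c"
  shows "implies I a c"
  unfolding implies_def
proof (intro ballI impI)
  fix s assume s: "s \<in> situations I" "holds I a s"
  then have "holds I b s" using assms(1) unfolding implies_def by blast
  with s(1) show "holds I c s" using assms(2) unfolding implies_def by blast
qed

lemma incompatible_mono:
  assumes "incompatible I a b" "implies I a' a" "implies I b' b"
  shows "incompatible I a' b'"
  unfolding incompatible_def
proof
  assume "\<exists>s \<in> situations I. holds I a' s \<and> holds I b' s"
  then obtain s where s: "s \<in> situations I" "holds I a' s" "holds I b' s" by blast
  have "holds I a s" using s(1,2) assms(2) unfolding implies_def by blast
  moreover have "holds I b s" using s(1,3) assms(3) unfolding implies_def by blast
  ultimately show False using s(1) assms(1) unfolding incompatible_def by blast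
qed

lemma equiv_equiv_rel: "equiv (set (answers I)) (equiv_rel I)"
proof (rule equivI)
  show "equiv_rel I \<subseteq> set (answers I) \<times> set (answers I)"
    unfolding equiv_rel_def by blast
  show "refl_on (set (answers I)) (equiv_rel I)"
    by (rule refl_onI) (simp add: equiv_rel_def equivalent_def implies_refl)
  show "sym (equiv_rel I)"
    by (rule symI) (simp add: equiv_rel_def equivalent_def)
  show "trans (equiv_rel I)"
    by (rule transI) (auto simp: equiv_rel_def equivalent_def intro: implies_trans)
qed

lemma cluster_members_equivalent:
  assumes "c \<in> clusters I" "a \<in> c" "b \<in> c"
  shows "equivalent I a b"
proof -
  have "(a, b) \<in> equiv_rel I"
    using quotient_eq_iff[OF equiv_equiv_rel, of c I c a b] assms by (simp add: clusters_def)
  then show ?thesis by (simp add: equiv_rel_def)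
qed

lemma cluster_implies_iff:
  assumes "c \<in> clusters I" "d \<in> clusters I" "a \<in> c" "b \<in> d"
  shows "cluster_implies I c d \<longleftrightarrow> implies I a b"
proof
  assume "cluster_implies I c d"
  then obtain a' b' where *: "a' \<in> c" "b' \<in> d" "implies I a' b'"
    unfolding cluster_implies_def by blast
  have "equivalent I a a'" "equivalent I b' b"
    using assms * by (simp_all add: cluster_members_equivalent)
  with * show "implies I a b" unfolding equivalent_def by (blast intro: implies_trans)
next
  assume "implies I a b"
  then show "cluster_implies I c d" using assms unfolding cluster_implies_def by blast
qed

lemma cluster_incompatible_iff:
  assumes "c \<in> clusters I" "d \<in> clusters I" "a \<in> c" "b \<in> d"
  shows "cluster_incompatible I c d \<longleftrightarrow> incompatible I a b"
proof
  assume "cluster_incompatible I c d"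
  then obtain a' b' where *: "a' \<in> c" "b' \<in> d" "incompatible I a' b'"
    unfolding cluster_incompatible_def by blast
  have "equivalent I a a'" "equivalent I b b'"
    using assms * by (simp_all add: cluster_members_equivalent)
  with * show "incompatible I a b" unfolding equivalent_def by (blast intro: incompatible_mono)
next
  assume "incompatible I a b"
  then show "cluster_incompatible I c d" using assms unfolding cluster_incompatible_def by blast
qed


section \<open>Implication graph, incompatibility graph and the uncertainty measures\<close>

definition ImG :: "('a, 's) sample \<Rightarrow> 'a set pair_pre_digraph" where
  "ImG I = \<lparr> pverts = clusters I,
             parcs = {(c, d). c \<in> clusters I \<and> d \<in> clusters I \<and> c \<noteq> d \<and> cluster_implies I c d} \<rparr>"

definition roots :: "('a, 's) sample \<Rightarrow> 'a set set" where
  "roots I = {r \<in> pverts (ImG I). in_degree (with_proj (ImG I)) r = 0}"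

definition InG :: "('a, 's) sample \<Rightarrow> 'a set pair_pre_digraph" where
  "InG I = \<lparr> pverts = roots I,
             parcs = {(c, d). c \<in> roots I \<and> d \<in> roots I \<and> c \<noteq> d \<and> cluster_incompatible I c d} \<rparr>"

definition Reach :: "('a, 's) sample \<Rightarrow> 'a set \<Rightarrow> 'a set set" where
  "Reach I r = {c. reachable (with_proj (ImG I)) r c}"

definition reach_prob :: "('a, 's) sample \<Rightarrow> 'a set \<Rightarrow> real" where
  "reach_prob I r = (\<Sum>c \<in> Reach I r. cluster_prob I c)"

definition root_prob :: "('a, 's) sample \<Rightarrow> 'a set \<Rightarrow> real" where
  "root_prob I r = reach_prob I r / (\<Sum>r' \<in> roots I. reach_prob I r')"

text \<open>Since \<open>0 * ln 0 = 0\<close> here, roots of probability zero do not contribute.\<close>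

definition IGE :: "('a, 's) sample \<Rightarrow> real" where
  "IGE I = - (\<Sum>r \<in> roots I. root_prob I r * ln (root_prob I r))"

definition LGU :: "('a set pair_pre_digraph \<Rightarrow> real) \<Rightarrow> ('a, 's) sample \<Rightarrow> real" where
  "LGU InS I = (1 + InS (InG I)) * IGE I"


section \<open>A unit-cost random access machine with pairwise checks\<close>

text \<open>
  Programs operate on arrays of natural numbers and arrays of reals; the arrays are numbered and
  unbounded, and a scalar variable is an array of which only one cell is used. Real numbers are
  exact and, as usual for real RAMs, programs may contain fixed real constants. Every arithmetic
  operation, constant, memory access, comparison, branch, assignment and
  pairwise check costs one unit of time, so bookkeeping is not free.
\<close>

record mem =
  nmem :: "nat \<Rightarrow> nat \<Rightarrow> nat"
  rmem :: "nat \<Rightarrow> nat \<Rightarrow> real"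

datatype nat_op = NAdd | NSub | NMul | NDiv

datatype real_op = RAdd | RSub | RMul | RDiv

datatype nexp =
    NConst nat
  | NGet nat nexp  \<comment> \<open>array number, index\<close>
  | NOp nat_op nexp nexp

datatype rexp =
    RConst real
  | RGet nat nexp
  | ROfNat nexp
  | ROp real_op rexp rexp
  | RLn rexp

datatype test = NLess nexp nexp | NEq nexp nexp | RLess rexp rexp | REq rexp rexp

datatype check_kind = Equiv | Implies | Incompat

text \<open>\<open>Check k e1 e2 a e\<close> stores the outcome of the check \<open>k\<close> on the answers number \<open>e1\<close> and \<open>e2\<close>,
  as 0 or 1, in cell \<open>e\<close> of array \<open>a\<close>.\<close>

datatype com =
    Skip
  | NSet nat nexp nexp  \<comment> \<open>array number, index, value\<close>
  | RSet nat nexp rexp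
  | Check check_kind nexp nexp nat nexp
  | Seq com com
  | If test com com
  | While test com

fun nat_op_val :: "nat_op \<Rightarrow> nat \<Rightarrow> nat \<Rightarrow> nat" where
  "nat_op_val NAdd x y = x + y"
| "nat_op_val NSub x y = x - y"
| "nat_op_val NMul x y = x * y"
| "nat_op_val NDiv x y = x div y"

fun real_op_val :: "real_op \<Rightarrow> real \<Rightarrow> real \<Rightarrow> real" where
  "real_op_val RAdd x y = x + y"
| "real_op_val RSub x y = x - y"
| "real_op_val RMul x y = x * y"
| "real_op_val RDiv x y = x / y"

primrec nval :: "mem \<Rightarrow> nexp \<Rightarrow> nat" where
  "nval s (NConst m) = m"
| "nval s (NGet a e) = nmem s a (nval s e)"
| "nval s (NOp f e1 e2) = nat_op_val f (nval s e1) (nval s e2)"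

primrec rval :: "mem \<Rightarrow> rexp \<Rightarrow> real" where
  "rval s (RConst x) = x"
| "rval s (RGet a e) = rmem s a (nval s e)"
| "rval s (ROfNat e) = real (nval s e)"
| "rval s (ROp f e1 e2) = real_op_val f (rval s e1) (rval s e2)"
| "rval s (RLn e) = ln (rval s e)"

primrec tval :: "mem \<Rightarrow> test \<Rightarrow> bool" where
  "tval s (NLess e1 e2) \<longleftrightarrow> nval s e1 < nval s e2"
| "tval s (NEq e1 e2) \<longleftrightarrow> nval s e1 = nval s e2"
| "tval s (RLess e1 e2) \<longleftrightarrow> rval s e1 < rval s e2"
| "tval s (REq e1 e2) \<longleftrightarrow> rval s e1 = rval s e2"

primrec ncost :: "nexp \<Rightarrow> nat" where
  "ncost (NConst m) = 1"
| "ncost (NGet a e) = 1 + ncost e"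
| "ncost (NOp f e1 e2) = 1 + ncost e1 + ncost e2"

primrec rcost :: "rexp \<Rightarrow> nat" where
  "rcost (RConst x) = 1"
| "rcost (RGet a e) = 1 + ncost e"
| "rcost (ROfNat e) = 1 + ncost e"
| "rcost (ROp f e1 e2) = 1 + rcost e1 + rcost e2"
| "rcost (RLn e) = 1 + rcost e"

primrec tcost :: "test \<Rightarrow> nat" where
  "tcost (NLess e1 e2) = 1 + ncost e1 + ncost e2"
| "tcost (NEq e1 e2) = 1 + ncost e1 + ncost e2"
| "tcost (RLess e1 e2) = 1 + rcost e1 + rcost e2"
| "tcost (REq e1 e2) = 1 + rcost e1 + rcost e2"

definition nset :: "nat \<Rightarrow> nat \<Rightarrow> nat \<Rightarrow> mem \<Rightarrow> mem" where
  "nset a i x s = s\<lparr>nmem := (nmem s)(a := (nmem s a)(i := x))\<rparr>"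

definition rset :: "nat \<Rightarrow> nat \<Rightarrow> real \<Rightarrow> mem \<Rightarrow> mem" where
  "rset a i x s = s\<lparr>rmem := (rmem s)(a := (rmem s a)(i := x))\<rparr>"

type_synonym checker = "check_kind \<Rightarrow> nat \<Rightarrow> nat \<Rightarrow> bool"

text \<open>\<open>exec chk c s t q s'\<close>: started in memory \<open>s\<close>, the program \<open>c\<close> halts in memory \<open>s'\<close> after \<open>t\<close>
  units of time, \<open>q\<close> of which are pairwise checks.\<close>

inductive exec :: "checker \<Rightarrow> com \<Rightarrow> mem \<Rightarrow> nat \<Rightarrow> nat \<Rightarrow> mem \<Rightarrow> bool" for chk where
  Skip: "exec chk Skip s 1 0 s"
| NSet: "exec chk (NSet a i e) s (1 + ncost i + ncost e) 0 (nset a (nval s i) (nval s e) s)"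
| RSet: "exec chk (RSet a i e) s (1 + ncost i + rcost e) 0 (rset a (nval s i) (rval s e) s)"
| Check: "exec chk (Check k e1 e2 a i) s (1 + ncost e1 + ncost e2 + ncost i) 1
            (nset a (nval s i) (of_bool (chk k (nval s e1) (nval s e2))) s)"
| Seq: "exec chk c1 s1 t1 q1 s2 \<Longrightarrow> exec chk c2 s2 t2 q2 s3 \<Longrightarrow>
        exec chk (Seq c1 c2) s1 (t1 + t2) (q1 + q2) s3"
| IfTrue: "tval s b \<Longrightarrow> exec chk c1 s t q s' \<Longrightarrow> exec chk (If b c1 c2) s (1 + tcost b + t) q s'"
| IfFalse: "\<not> tval s b \<Longrightarrow> exec chk c2 s t q s' \<Longrightarrow> exec chk (If b c1 c2) s (1 + tcost b + t) q s'"
| WhileFalse: "\<not> tval s b \<Longrightarrow> exec chk (While b c) s (1 + tcost b) 0 s"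
| WhileTrue: "tval s1 b \<Longrightarrow> exec chk c s1 t1 q1 s2 \<Longrightarrow> exec chk (While b c) s2 t2 q2 s3 \<Longrightarrow>
        exec chk (While b c) s1 (1 + tcost b + t1 + t2) (q1 + q2) s3"

lemma exec_checks_le_time: "exec chk c s t q s' \<Longrightarrow> q \<le> t"
  by (induction rule: exec.induct) auto

inductive_cases exec_SkipE: "exec chk Skip s t q s'"
inductive_cases exec_NSetE: "exec chk (NSet a i e) s t q s'"
inductive_cases exec_RSetE: "exec chk (RSet a i e) s t q s'"
inductive_cases exec_CheckE: "exec chk (Check k e1 e2 a i) s t q s'"
inductive_cases exec_SeqE: "exec chk (Seq c1 c2) s t q s'"
inductive_cases exec_IfE: "exec chk (If b c1 c2) s t q s'"
inductive_cases exec_WhileE: "exec chk (While b c) s t q s'"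

lemma exec_deterministic:
  "exec chk c s t q s' \<Longrightarrow> exec chk c s u r s'' \<Longrightarrow> u = t \<and> r = q \<and> s'' = s'"
proof (induction arbitrary: u r s'' rule: exec.induct)
  case (Skip s)
  from this show ?case by (rule exec_SkipE) simp
next
  case (NSet a i e s)
  from this show ?case by (rule exec_NSetE) simp
next
  case (RSet a i e s)
  from this show ?case by (rule exec_RSetE) simp
next
  case (Check k e1 e2 a i s)
  from this show ?case by (rule exec_CheckE) simp
next
  case (Seq c1 s1 t1 q1 s2 c2 t2 q2 s3)
  from Seq.prems show ?case
  proof (rule exec_SeqE)
    fix t1' q1' s2' t2' q2'
    assume *: "u = t1' + t2'" "r = q1' + q2'" "exec chk c1 s1 t1' q1' s2'" "exec chk c2 s2' t2' q2' s''"
    from Seq.IH(1)[OF *(3)] have "t1' = t1" "q1' = q1" "s2' = s2" by simp_all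
    with Seq.IH(2)[of t2' q2' s''] * show ?thesis by simp
  qed
next
  case (IfTrue s b c1 t q s' c2)
  from IfTrue.prems show ?case
  proof (rule exec_IfE)
    fix t' assume *: "u = Suc (tcost b + t')" "exec chk c1 s t' r s''"
    from IfTrue.IH[OF *(2)] *(1) show ?thesis by simp
  qed (simp add: IfTrue.hyps(1))
next
  case (IfFalse s b c2 t q s' c1)
  from IfFalse.prems show ?case
  proof (rule exec_IfE)
    fix t' assume *: "u = Suc (tcost b + t')" "exec chk c2 s t' r s''"
    from IfFalse.IH[OF *(2)] *(1) show ?thesis by simp
  qed (simp add: IfFalse.hyps(1))
next
  case (WhileFalse s b c)
  from WhileFalse.prems show ?case
    by (rule exec_WhileE) (simp_all add: WhileFalse.hyps)
next
  case (WhileTrue s1 b c t1 q1 s2 t2 q2 s3)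
  from WhileTrue.prems show ?case
  proof (rule exec_WhileE)
    fix t1' q1' s2' t2' q2'
    assume *: "u = Suc (tcost b + t1' + t2')" "r = q1' + q2'"
      "exec chk c s1 t1' q1' s2'" "exec chk (While b c) s2' t2' q2' s''"
    from WhileTrue.IH(1)[OF *(3)] have "t1' = t1" "q1' = q1" "s2' = s2" by simp_all
    with WhileTrue.IH(2)[of t2' q2' s''] * show ?thesis by simp
  qed (simp add: WhileTrue.hyps(1))
qed


section \<open>Programs for scores and for the LGU\<close>

text \<open>
  A digraph whose vertices are enumerated as \<open>vs\<close> is presented by its number of vertices \<open>k\<close>, in
  cell 0 of array 0, and by its adjacency matrix, row by row, in array 1. The memory is zero
  otherwise. The result of a program is expected in cell 0 of the real array 0.
\<close>

definition graph_mem :: "'v pair_pre_digraph \<Rightarrow> 'v list \<Rightarrow> mem" where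
  "graph_mem G vs =
    (let k = length vs in
     \<lparr> nmem = (\<lambda>a i. if a = 0 \<and> i = 0 then k
                     else if a = 1 \<and> i < k * k
                     then of_bool ((vs ! (i div k), vs ! (i mod k)) \<in> parcs G)
                     else 0),
       rmem = (\<lambda>_ _. 0) \<rparr>)"

primrec check_free :: "com \<Rightarrow> bool" where
  "check_free Skip \<longleftrightarrow> True"
| "check_free (NSet a i e) \<longleftrightarrow> True"
| "check_free (RSet a i e) \<longleftrightarrow> True"
| "check_free (Check k e1 e2 a i) \<longleftrightarrow> False"
| "check_free (Seq c1 c2) \<longleftrightarrow> check_free c1 \<and> check_free c2"
| "check_free (If b c1 c2) \<longleftrightarrow> check_free c1 \<and> check_free c2"
| "check_free (While b c) \<longleftrightarrow> check_free c"

text \<open>The program must be correct for every enumeration of the vertices, so it can only compute a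
  function of the graph up to isomorphism. The checker is irrelevant to a check-free program.\<close>

definition quadratic_time_score :: "('v pair_pre_digraph \<Rightarrow> real) \<Rightarrow> bool" where
  "quadratic_time_score f \<longleftrightarrow>
     (\<exists>Q (T :: nat \<Rightarrow> nat). check_free Q \<and> (\<lambda>k. real (T k)) \<in> O(\<lambda>k. real k ^ 2) \<and>
        (\<forall>G vs. pair_digraph G \<and> distinct vs \<and> set vs = pverts G \<longrightarrow>
           (\<exists>t s'. exec (\<lambda>_ _ _. False) Q (graph_mem G vs) t 0 s' \<and>
                   t \<le> T (length vs) \<and> rmem s' 0 0 = f G)))"

text \<open>The relations between answers are not part of the memory; answers are named by their positions
  in the list, and checks involving any other number fail.\<close>

definition answer_checker :: "('a, 's) sample \<Rightarrow> checker" where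
  "answer_checker I k i j \<longleftrightarrow> i < num_answers I \<and> j < num_answers I \<and>
     (case k of
        Equiv \<Rightarrow> equivalent I (answers I ! i) (answers I ! j)
      | Implies \<Rightarrow> implies I (answers I ! i) (answers I ! j)
      | Incompat \<Rightarrow> incompatible I (answers I ! i) (answers I ! j))"

definition sample_mem :: "('a, 's) sample \<Rightarrow> mem" where
  "sample_mem I =
     \<lparr> nmem = (\<lambda>a i. if a = 0 \<and> i = 0 then num_answers I else 0),
       rmem = (\<lambda>a i. if a = 0 \<and> i < num_answers I then weights I ! i else 0) \<rparr>"

definition computes_LGU ::
  "('a set pair_pre_digraph \<Rightarrow> real) \<Rightarrow> com \<Rightarrow> ('a, 's) sample \<Rightarrow> nat \<Rightarrow> nat \<Rightarrow> bool" where
  "computes_LGU InS P I t q \<longleftrightarrow>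
     (\<exists>s'. exec (answer_checker I) P (sample_mem I) t q s' \<and> rmem s' 0 0 = LGU InS I)"

end

(*
  Upper bound. Implication is transitive, so the mass reachable from a root is the total weight of
  the sampled answers it implies, and a cluster is a root iff its first sampled answer is implied
  only by answers equivalent to it. Comparing all pairs of answers thus yields the roots and their
  masses; the incompatibility graph on at most n roots is tabulated with one more check per pair and
  handed to the program for the score.

  Lower bound. Put all the weight on an answer r and on about n/2 answers implied by r, and let the
  other n/2 answers have weight zero and imply nothing. Then r carries all the root probability and
  the LGU is 0. Letting one weightless answer imply one of the weighted answers gives a second root
  of positive probability, so the LGU becomes positive whatever the score, yet only the implication
  check on that pair changes its outcome. Hence all of the roughly (n/2)^2 pairs must be checked.
*)

theory Submission
  imports Defs
begin

section \<open>The measures in terms of answer indices\<close>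

definition cluster_of :: "('a, 's) sample \<Rightarrow> nat \<Rightarrow> 'a set" where
  "cluster_of I i = equiv_rel I `` {answers I ! i}"

definition index_implies :: "('a, 's) sample \<Rightarrow> nat \<Rightarrow> nat \<Rightarrow> bool" where
  "index_implies I i j \<longleftrightarrow> implies I (answers I ! i) (answers I ! j)"

text \<open>The conjunct \<open>i \<le> j\<close> selects the least index among equivalent answers,
  so each root cluster is represented by exactly one index and the program can find the roots
  without ever building the clusters.\<close>

definition root_index :: "('a, 's) sample \<Rightarrow> nat \<Rightarrow> bool" where
  "root_index I i \<longleftrightarrow>
     (\<forall>j < num_answers I. index_implies I j i \<longrightarrow> index_implies I i j \<and> i \<le> j)"

definition root_indices :: "('a, 's) sample \<Rightarrow> nat set" where
  "root_indices I = {i. i < num_answers I \<and> root_index I i}"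

definition mass :: "('a, 's) sample \<Rightarrow> nat \<Rightarrow> real" where
  "mass I i = (\<Sum>j | j < num_answers I \<and> index_implies I i j. weights I ! j)"

lemma index_implies_refl: "index_implies I i i"
  by (simp add: index_implies_def implies_refl)

lemma index_implies_trans:
  "index_implies I i j \<Longrightarrow> index_implies I j k \<Longrightarrow> index_implies I i k"
  unfolding index_implies_def by (rule implies_trans)

lemma finite_root_indices: "finite (root_indices I)"
  by (simp add: root_indices_def)

lemma mem_cluster_of_iff:
  assumes "i < num_answers I" "j < num_answers I"
  shows "answers I ! j \<in> cluster_of I i \<longleftrightarrow> index_implies I i j \<and> index_implies I j i"
  using assms
  by (auto simp: cluster_of_def equiv_rel_def num_answers_def equivalent_def index_implies_def)

lemma cluster_of_in_clusters:
  assumes "i < num_answers I"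
  shows "cluster_of I i \<in> clusters I"
  using assms by (auto simp: cluster_of_def clusters_def num_answers_def intro: quotientI)

lemma mem_cluster_of_self:
  assumes "i < num_answers I"
  shows "answers I ! i \<in> cluster_of I i"
  using assms by (simp add: mem_cluster_of_iff index_implies_refl)

lemma clusters_eq: "clusters I = cluster_of I ` {..<num_answers I}"
proof
  show "clusters I \<subseteq> cluster_of I ` {..<num_answers I}"
    by (auto simp: clusters_def cluster_of_def num_answers_def in_set_conv_nth elim!: quotientE)
qed (auto intro: cluster_of_in_clusters)

lemma finite_clusters: "finite (clusters I)"
  by (simp add: clusters_eq)

lemma cluster_of_eq_iff:
  assumes "i < num_answers I" "j < num_answers I"
  shows "cluster_of I i = cluster_of I j \<longleftrightarrow> index_implies I i j \<and> index_implies I j i"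
proof -
  have "cluster_of I i = cluster_of I j \<longleftrightarrow> (answers I ! i, answers I ! j) \<in> equiv_rel I"
    unfolding cluster_of_def using assms
    by (intro eq_equiv_class_iff[OF equiv_equiv_rel]) (auto simp: num_answers_def)
  then show ?thesis
    using assms mem_cluster_of_iff[OF assms] by (simp add: cluster_of_def)
qed

lemma cluster_implies_cluster_of:
  assumes "i < num_answers I" "j < num_answers I"
  shows "cluster_implies I (cluster_of I i) (cluster_of I j) \<longleftrightarrow> index_implies I i j"
  unfolding index_implies_def
  using assms by (intro cluster_implies_iff cluster_of_in_clusters mem_cluster_of_self)

lemma cluster_incompatible_cluster_of:
  assumes "i < num_answers I" "j < num_answers I"
  shows "cluster_incompatible I (cluster_of I i) (cluster_of I j) \<longleftrightarrow>
    incompatible I (answers I ! i) (answers I ! j)"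
  using assms by (intro cluster_incompatible_iff cluster_of_in_clusters mem_cluster_of_self)

lemma mem_roots_iff:
  "r \<in> roots I \<longleftrightarrow>
     r \<in> clusters I \<and> (\<forall>c \<in> clusters I. cluster_implies I c r \<longrightarrow> c = r)"
proof -
  \<comment> \<open>\<open>card\<close> of an infinite set is 0, so in-degree 0 excludes incoming
    arcs only once finiteness is established.\<close>
  have "finite (parcs (ImG I))"
    by (rule finite_subset[OF _ finite_cartesian_product[OF finite_clusters finite_clusters]])
      (auto simp: ImG_def)
  then have "finite (in_arcs (with_proj (ImG I)) r)"
    by (auto simp: in_arcs_def)
  then have "in_degree (with_proj (ImG I)) r = 0 \<longleftrightarrow> in_arcs (with_proj (ImG I)) r = {}"
    by (simp add: in_degree_def)
  then show ?thesis
    by (auto simp: roots_def in_arcs_def ImG_def)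
qed

lemma roots_eq: "roots I = cluster_of I ` root_indices I"
proof (intro equalityI subsetI)
  fix r assume r: "r \<in> roots I"
  \<comment> \<open>The representative of the root \<open>r\<close> is the least index in its
    cluster. Any index implying it lies in the same cluster, since a root has no other predecessor,
    and is therefore not smaller.\<close>
  define S where "S = {i. i < num_answers I \<and> cluster_of I i = r}"
  define i where "i = (LEAST i. i \<in> S)"
  have "S \<noteq> {}" using r by (auto simp: S_def mem_roots_iff clusters_eq)
  then have i: "i \<in> S" unfolding i_def by (meson LeastI_ex ex_in_conv)
  have least: "i \<le> j" if "j \<in> S" for j unfolding i_def using that by (rule Least_le)
  have "index_implies I i j \<and> i \<le> j" if j: "j < num_answers I" "index_implies I j i" for j
  proof -
    have "cluster_of I j = r"
    proof -
      have "cluster_implies I (cluster_of I j) r"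
        using i j cluster_implies_cluster_of[of j I i] by (simp add: S_def)
      then show ?thesis using r cluster_of_in_clusters[OF j(1)] unfolding mem_roots_iff by blast
    qed
    then have "j \<in> S" using j by (simp add: S_def)
    then show ?thesis using i j \<open>cluster_of I j = r\<close> least cluster_of_eq_iff[of i I j]
      by (simp add: S_def)
  qed
  then have "i \<in> root_indices I" using i by (auto simp: root_indices_def root_index_def S_def)
  then show "r \<in> cluster_of I ` root_indices I" using i by (auto simp: S_def)
next
  fix r assume "r \<in> cluster_of I ` root_indices I"
  then obtain i where i: "i < num_answers I" "root_index I i" "r = cluster_of I i"
    by (auto simp: root_indices_def)
  have "cluster_of I j = r" if "j < num_answers I" "cluster_implies I (cluster_of I j) r" for j
    using i that cluster_implies_cluster_of[of j I i] cluster_of_eq_iff[of j I i]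
    by (simp add: root_index_def)
  then show "r \<in> roots I"
    using i cluster_of_in_clusters[of i I] by (auto simp: mem_roots_iff clusters_eq)
qed

lemma inj_on_cluster_of: "inj_on (cluster_of I) (root_indices I)"
proof (rule inj_onI)
  fix i j assume *: "i \<in> root_indices I" "j \<in> root_indices I" "cluster_of I i = cluster_of I j"
  then have "index_implies I i j" "index_implies I j i"
    by (simp_all add: root_indices_def cluster_of_eq_iff)
  then have "i \<le> j" "j \<le> i"
    using *(1,2) unfolding root_indices_def root_index_def by blast+
  then show "i = j" by simp
qed

text \<open>Implication is transitive, so reachability is a single step.\<close>

lemma mem_Reach_iff:
  assumes "r \<in> clusters I"
  shows "c \<in> Reach I r \<longleftrightarrow> c \<in> clusters I \<and> cluster_implies I r c"
proof
  obtain i where i: "i < num_answers I" "r = cluster_of I i" using assms by (auto simp: clusters_eq)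
  assume "c \<in> Reach I r"
  then have "(r, c) \<in> rtrancl_on (clusters I) (parcs (ImG I))"
    by (simp add: Reach_def reachable_def ImG_def)
  then show "c \<in> clusters I \<and> cluster_implies I r c"
  proof (induction rule: rtrancl_on_induct)
    case base
    then show ?case using i by (auto simp: cluster_implies_cluster_of index_implies_refl)
  next
    case (step y z)
    then show ?case using i
      by (auto simp: ImG_def clusters_eq cluster_implies_cluster_of intro: index_implies_trans)
  qed
next
  assume "c \<in> clusters I \<and> cluster_implies I r c"
  with assms show "c \<in> Reach I r"
    using rtrancl_on_into_rtrancl_on[OF rtrancl_on_refl, of r "clusters I" c "parcs (ImG I)"]
    by (cases "c = r") (auto simp: Reach_def reachable_def ImG_def)
qed

text \<open>Clusters are disjoint, so the double sum over reachable clusters and their members is a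
  single sum over answers; by transitivity these are the answers that answer \<open>i\<close>
  implies.\<close>

lemma reach_prob_cluster_of:
  assumes "i < num_answers I"
  shows "reach_prob I (cluster_of I i) = mass I i"
proof -
  let ?R = "Reach I (cluster_of I i)"
  let ?members = "\<lambda>c. {j. j < num_answers I \<and> answers I ! j \<in> c}"
  have R: "?R = {c \<in> clusters I. cluster_implies I (cluster_of I i) c}"
    using assms by (auto simp: mem_Reach_iff cluster_of_in_clusters)
  have "reach_prob I (cluster_of I i) = (\<Sum>j \<in> (\<Union>c \<in> ?R. ?members c). weights I ! j)"
    unfolding reach_prob_def cluster_prob_def
  proof (rule sum.UNION_disjoint[symmetric])
    show "finite ?R" by (simp add: R finite_clusters)
    show "\<forall>c \<in> ?R. \<forall>d \<in> ?R. c \<noteq> d \<longrightarrow> ?members c \<inter> ?members d = {}"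
      using quotient_disj[OF equiv_equiv_rel] unfolding R clusters_def by blast
  qed simp
  also have "(\<Union>c \<in> ?R. ?members c) = {j. j < num_answers I \<and> index_implies I i j}"
  proof (intro equalityI subsetI)
    fix j assume "j \<in> (\<Union>c \<in> ?R. ?members c)"
    then show "j \<in> {j. j < num_answers I \<and> index_implies I i j}"
      using assms
      by (auto simp: R clusters_eq cluster_implies_cluster_of mem_cluster_of_iff
          intro: index_implies_trans)
  next
    fix j assume "j \<in> {j. j < num_answers I \<and> index_implies I i j}"
    then have "cluster_of I j \<in> ?R" "j \<in> ?members (cluster_of I j)"
      using assms
      by (auto simp: R cluster_of_in_clusters cluster_implies_cluster_of mem_cluster_of_self)
    then show "j \<in> (\<Union>c \<in> ?R. ?members c)" by blast
  qed
  finally show ?thesis by (simp add: mass_def)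
qed

lemma sum_roots: "(\<Sum>r \<in> roots I. f r) = (\<Sum>i \<in> root_indices I. f (cluster_of I i))"
  by (simp add: roots_eq sum.reindex[OF inj_on_cluster_of])

definition index_prob :: "('a, 's) sample \<Rightarrow> nat \<Rightarrow> real" where
  "index_prob I i = mass I i / (\<Sum>j \<in> root_indices I. mass I j)"

lemma IGE_eq: "IGE I = - (\<Sum>i \<in> root_indices I. index_prob I i * ln (index_prob I i))"
proof -
  have "reach_prob I (cluster_of I i) = mass I i" if "i \<in> root_indices I" for i
    using that by (simp add: root_indices_def reach_prob_cluster_of)
  then show ?thesis
    by (simp add: IGE_def sum_roots root_prob_def index_prob_def cong: sum.cong)
qed

lemma pair_digraph_InG: "pair_digraph (InG I)"
proof
  show fin: "finite (pverts (InG I))"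
    by (simp add: InG_def roots_eq finite_root_indices)
  show "finite (parcs (InG I))"
    by (rule finite_subset[OF _ finite_cartesian_product[OF fin fin]]) (auto simp: InG_def)
qed (auto simp: InG_def)

text \<open>An answer true in no situation is incompatible with itself, so
  \<open>i \<noteq> j\<close> is a real condition. It expresses distinctness of the clusters because
  \<open>cluster_of\<close> is injective on root indices.\<close>

lemma mem_parcs_InG_iff:
  assumes "i \<in> root_indices I" "j \<in> root_indices I"
  shows "(cluster_of I i, cluster_of I j) \<in> parcs (InG I) \<longleftrightarrow>
    i \<noteq> j \<and> incompatible I (answers I ! i) (answers I ! j)"
proof -
  have "cluster_of I i = cluster_of I j \<longleftrightarrow> i = j"
    using assms inj_on_cluster_of by (metis inj_on_def)
  then show ?thesis
    using assms by (auto simp: InG_def roots_eq root_indices_def cluster_incompatible_cluster_of)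
qed

section \<open>Reasoning about programs with time bounds\<close>

lemma nmem_nset [simp]: "nmem (nset a i x s) b j = (if b = a \<and> j = i then x else nmem s b j)"
  by (simp add: nset_def)

lemma rmem_nset [simp]: "rmem (nset a i x s) = rmem s"
  by (simp add: nset_def)

lemma rmem_rset [simp]: "rmem (rset a i x s) b j = (if b = a \<and> j = i then x else rmem s b j)"
  by (simp add: rset_def)

lemma nmem_rset [simp]: "nmem (rset a i x s) = nmem s"
  by (simp add: rset_def)

text \<open>Total correctness with a time bound. The number of checks is quantified away, as each
  check already counts towards the time.\<close>

definition runs :: "checker \<Rightarrow> com \<Rightarrow> mem \<Rightarrow> nat \<Rightarrow> (mem \<Rightarrow> bool) \<Rightarrow> bool" where
  "runs chk c s B post \<longleftrightarrow> (\<exists>t q s'. exec chk c s t q s' \<and> t \<le> B \<and> post s')"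

lemma runsI:
  assumes "exec chk c s t q s'" "t \<le> B" "post s'"
  shows "runs chk c s B post"
  using assms unfolding runs_def by blast

lemma runsE:
  assumes "runs chk c s B post"
  obtains t q s' where "exec chk c s t q s'" "t \<le> B" "post s'"
  using assms unfolding runs_def by blast

lemma runs_mono:
  assumes "runs chk c s B post" "B \<le> B'" "\<And>s'. post s' \<Longrightarrow> post' s'"
  shows "runs chk c s B' post'"
  using assms unfolding runs_def by (meson le_trans)

text \<open>The triple for the second command sits in the postcondition of the first, in
  weakest-precondition style, so backward chaining needs no named intermediate assertion.\<close>

lemma runs_Seq:
  assumes "runs chk c1 s B1 (\<lambda>s'. runs chk c2 s' B2 post)"
  shows "runs chk (Seq c1 c2) s (B1 + B2) post"
proof -
  obtain t1 q1 s1 where 1: "exec chk c1 s t1 q1 s1" "t1 \<le> B1" "runs chk c2 s1 B2 post"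
    using assms by (rule runsE)
  obtain t2 q2 s2 where 2: "exec chk c2 s1 t2 q2 s2" "t2 \<le> B2" "post s2"
    using 1(3) by (rule runsE)
  show ?thesis using exec.Seq[OF 1(1) 2(1)] by (rule runsI) (use 1 2 in auto)
qed

primrec loop_free :: "com \<Rightarrow> bool" where
  "loop_free Skip \<longleftrightarrow> True"
| "loop_free (NSet a i e) \<longleftrightarrow> True"
| "loop_free (RSet a i e) \<longleftrightarrow> True"
| "loop_free (Check k e1 e2 a i) \<longleftrightarrow> True"
| "loop_free (Seq c1 c2) \<longleftrightarrow> loop_free c1 \<and> loop_free c2"
| "loop_free (If b c1 c2) \<longleftrightarrow> loop_free c1 \<and> loop_free c2"
| "loop_free (While b c) \<longleftrightarrow> False"

text \<open>In the following two functions the values for \<open>While\<close> are junk.\<close>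

primrec effect :: "checker \<Rightarrow> com \<Rightarrow> mem \<Rightarrow> mem" where
  "effect chk Skip s = s"
| "effect chk (NSet a i e) s = nset a (nval s i) (nval s e) s"
| "effect chk (RSet a i e) s = rset a (nval s i) (rval s e) s"
| "effect chk (Check k e1 e2 a i) s =
     nset a (nval s i) (of_bool (chk k (nval s e1) (nval s e2))) s"
| "effect chk (Seq c1 c2) s = effect chk c2 (effect chk c1 s)"
| "effect chk (If b c1 c2) s = (if tval s b then effect chk c1 s else effect chk c2 s)"
| "effect chk (While b c) s = s"

primrec time_bound :: "com \<Rightarrow> nat" where
  "time_bound Skip = 1"
| "time_bound (NSet a i e) = 1 + ncost i + ncost e"
| "time_bound (RSet a i e) = 1 + ncost i + rcost e"
| "time_bound (Check k e1 e2 a i) = 1 + ncost e1 + ncost e2 + ncost i"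
| "time_bound (Seq c1 c2) = time_bound c1 + time_bound c2"
| "time_bound (If b c1 c2) = 1 + tcost b + max (time_bound c1) (time_bound c2)"
| "time_bound (While b c) = 0"

text \<open>The time of loop-free code is bounded by its text alone, independently of the memory.
  Such pieces contribute only constants, and their correctness reduces to evaluating
  \<open>effect\<close>.\<close>

lemma exec_loop_free:
  "loop_free c \<Longrightarrow> \<exists>t q. exec chk c s t q (effect chk c s) \<and> t \<le> time_bound c"
proof (induction c arbitrary: s)
  case Skip
  then show ?case using exec.Skip by fastforce
next
  case (NSet a i e)
  then show ?case using exec.NSet by fastforce
next
  case (RSet a i e)
  then show ?case using exec.RSet by fastforce
next
  case (Check k e1 e2 a i)
  then show ?case using exec.Check by fastforce
next
  case (Seq c1 c2)
  then obtain t1 q1 t2 q2 where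
    "exec chk c1 s t1 q1 (effect chk c1 s)" "t1 \<le> time_bound c1"
    "exec chk c2 (effect chk c1 s) t2 q2 (effect chk c2 (effect chk c1 s))" "t2 \<le> time_bound c2"
    by (meson loop_free.simps(5))
  then show ?case using exec.Seq by (fastforce intro: add_mono)
next
  case (If b c1 c2)
  show ?case
  proof (cases "tval s b")
    case True
    obtain t q where "exec chk c1 s t q (effect chk c1 s)" "t \<le> time_bound c1"
      using If by (meson loop_free.simps(6))
    then show ?thesis using exec.IfTrue[OF True] True by fastforce
  next
    case False
    obtain t q where "exec chk c2 s t q (effect chk c2 s)" "t \<le> time_bound c2"
      using If by (meson loop_free.simps(6))
    then show ?thesis using exec.IfFalse[OF False] False by fastforce
  qed
qed simp

lemma runs_loop_free:
  assumes "loop_free c" "post (effect chk c s)"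
  shows "runs chk c s (time_bound c) post"
  using exec_loop_free[OF assms(1)] assms(2) unfolding runs_def by blast

abbreviation Var :: "nat \<Rightarrow> nexp" where
  "Var a \<equiv> NGet a (NConst 0)"

abbreviation NAssign :: "nat \<Rightarrow> nexp \<Rightarrow> com" where
  "NAssign a \<equiv> NSet a (NConst 0)"

definition For :: "nat \<Rightarrow> nexp \<Rightarrow> com \<Rightarrow> com" where
  "For v e c =
     Seq (NAssign v (NConst 0))
       (While (NLess (Var v) e) (Seq c (NAssign v (NOp NAdd (Var v) (NConst 1)))))"

text \<open>Initialization costs 3, each of the \<open>N + 1\<close> tests
  \<open>4 + ncost e\<close>, each increment 6. The invariant is stated after the counter update, so
  the body has to preserve the counter and to establish \<open>Inv\<close> for the memory with the
  incremented one.\<close>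

lemma runs_For:
  assumes init: "Inv 0 (nset v 0 0 s)"
    and bound: "\<And>i s. Inv i s \<Longrightarrow> nval s e = N"
    and body: "\<And>i s. Inv i s \<Longrightarrow> i < N \<Longrightarrow> nmem s v 0 = i \<Longrightarrow>
      runs chk c s B (\<lambda>s'. nmem s' v 0 = i \<and> Inv (Suc i) (nset v 0 (Suc i) s'))"
    and post: "\<And>s. Inv N s \<Longrightarrow> post s"
  shows "runs chk (For v e c) s (7 + ncost e + N * (10 + ncost e + B)) post"
proof -
  let ?incr = "NAssign v (NOp NAdd (Var v) (NConst 1))"
  let ?W = "While (NLess (Var v) e) (Seq c ?incr)"
  \<comment> \<open>Here \<open>d\<close> is the number of rounds still to run.\<close>
  have loop: "runs chk ?W s (4 + ncost e + d * (10 + ncost e + B)) post"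
    if "Inv i s" "nmem s v 0 = i" "i + d = N" for i d s
    using that
  proof (induction d arbitrary: i s)
    case 0
    then have "\<not> tval s (NLess (Var v) e)" using bound by simp
    from exec.WhileFalse[OF this] show ?case
      by (rule runsI) (use 0 post in auto)
  next
    case (Suc d)
    have "i < N" using Suc.prems by simp
    then obtain t q s1 where
      c: "exec chk c s t q s1" "t \<le> B" "nmem s1 v 0 = i" "Inv (Suc i) (nset v 0 (Suc i) s1)"
      using body[OF Suc.prems(1) _ Suc.prems(2)] by (auto elim: runsE)
    have incr: "exec chk ?incr s1 6 0 (nset v 0 (Suc i) s1)"
      using exec.NSet[of chk v "NConst 0" "NOp NAdd (Var v) (NConst 1)" s1] c(3)
      by (simp add: numeral_eq_Suc)
    obtain t' q' s' where
      W: "exec chk ?W (nset v 0 (Suc i) s1) t' q' s'"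
        "t' \<le> 4 + ncost e + d * (10 + ncost e + B)" "post s'"
      using Suc.IH[OF c(4)] Suc.prems by (auto elim: runsE)
    have "tval s (NLess (Var v) e)" using Suc.prems bound by simp
    from exec.WhileTrue[OF this exec.Seq[OF c(1) incr] W(1)] show ?case
      by (rule runsI) (use c(2) W in auto)
  qed
  have "runs chk (For v e c) s (3 + (4 + ncost e + N * (10 + ncost e + B))) post"
    unfolding For_def
  proof (rule runs_Seq)
    have "runs chk (NAssign v (NConst 0)) s (time_bound (NAssign v (NConst 0)))
        (\<lambda>s'. runs chk ?W s' (4 + ncost e + N * (10 + ncost e + B)) post)"
      by (rule runs_loop_free) (use loop[OF init] in auto)
    then show "runs chk (NAssign v (NConst 0)) s 3
        (\<lambda>s'. runs chk ?W s' (4 + ncost e + N * (10 + ncost e + B)) post)"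
      by (simp add: numeral_3_eq_3)
  qed
  then show ?thesis by (simp add: add.assoc)
qed


section \<open>Running a subprogram in a shifted part of the memory\<close>

primrec shift_nexp :: "nat \<Rightarrow> nexp \<Rightarrow> nexp" where
  "shift_nexp d (NConst m) = NConst m"
| "shift_nexp d (NGet a e) = NGet (d + a) (shift_nexp d e)"
| "shift_nexp d (NOp f e1 e2) = NOp f (shift_nexp d e1) (shift_nexp d e2)"

primrec shift_rexp :: "nat \<Rightarrow> rexp \<Rightarrow> rexp" where
  "shift_rexp d (RConst x) = RConst x"
| "shift_rexp d (RGet a e) = RGet (d + a) (shift_nexp d e)"
| "shift_rexp d (ROfNat e) = ROfNat (shift_nexp d e)"
| "shift_rexp d (ROp f e1 e2) = ROp f (shift_rexp d e1) (shift_rexp d e2)"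
| "shift_rexp d (RLn e) = RLn (shift_rexp d e)"

primrec shift_test :: "nat \<Rightarrow> test \<Rightarrow> test" where
  "shift_test d (NLess e1 e2) = NLess (shift_nexp d e1) (shift_nexp d e2)"
| "shift_test d (NEq e1 e2) = NEq (shift_nexp d e1) (shift_nexp d e2)"
| "shift_test d (RLess e1 e2) = RLess (shift_rexp d e1) (shift_rexp d e2)"
| "shift_test d (REq e1 e2) = REq (shift_rexp d e1) (shift_rexp d e2)"

primrec shift_com :: "nat \<Rightarrow> com \<Rightarrow> com" where
  "shift_com d Skip = Skip"
| "shift_com d (NSet a i e) = NSet (d + a) (shift_nexp d i) (shift_nexp d e)"
| "shift_com d (RSet a i e) = RSet (d + a) (shift_nexp d i) (shift_rexp d e)"
| "shift_com d (Check k e1 e2 a i) =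
     Check k (shift_nexp d e1) (shift_nexp d e2) (d + a) (shift_nexp d i)"
| "shift_com d (Seq c1 c2) = Seq (shift_com d c1) (shift_com d c2)"
| "shift_com d (If b c1 c2) = If (shift_test d b) (shift_com d c1) (shift_com d c2)"
| "shift_com d (While b c) = While (shift_test d b) (shift_com d c)"

definition overlay :: "nat \<Rightarrow> mem \<Rightarrow> mem \<Rightarrow> mem" where
  "overlay d s0 s =
     \<lparr> nmem = (\<lambda>a. if a < d then nmem s0 a else nmem s (a - d)),
       rmem = (\<lambda>a. if a < d then rmem s0 a else rmem s (a - d)) \<rparr>"

lemma nval_shift: "nval (overlay d s0 s) (shift_nexp d e) = nval s e"
  by (induction e) (simp_all add: overlay_def)

lemma rval_shift: "rval (overlay d s0 s) (shift_rexp d e) = rval s e"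
  by (induction e) (simp_all add: nval_shift, simp add: overlay_def)

lemma tval_shift: "tval (overlay d s0 s) (shift_test d b) = tval s b"
  by (cases b) (simp_all add: nval_shift rval_shift)

lemma ncost_shift: "ncost (shift_nexp d e) = ncost e"
  by (induction e) simp_all

lemma rcost_shift: "rcost (shift_rexp d e) = rcost e"
  by (induction e) (simp_all add: ncost_shift)

lemma tcost_shift: "tcost (shift_test d b) = tcost b"
  by (cases b) (simp_all add: ncost_shift rcost_shift)

lemma overlay_nset: "overlay d s0 (nset a i x s) = nset (d + a) i x (overlay d s0 s)"
  by (auto simp: overlay_def nset_def fun_eq_iff)

lemma overlay_rset: "overlay d s0 (rset a i x s) = rset (d + a) i x (overlay d s0 s)"
  by (auto simp: overlay_def rset_def fun_eq_iff)

lemmas shift_simps =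
  nval_shift rval_shift tval_shift ncost_shift rcost_shift tcost_shift overlay_nset overlay_rset

text \<open>The score program may write to any array. Renumbered arrays \<open>d + a\<close> never
  lie below \<open>d\<close>, so the data of the surrounding program survive, and renumbering leaves
  every cost unchanged.\<close>

lemma exec_shift:
  "exec chk c s t q s' \<Longrightarrow> exec chk (shift_com d c) (overlay d s0 s) t q (overlay d s0 s')"
proof (induction rule: exec.induct)
  case (Skip s)
  show ?case using exec.Skip by simp
next
  case (NSet a i e s)
  then show ?case
    using exec.NSet[of chk "d + a" "shift_nexp d i" "shift_nexp d e" "overlay d s0 s"]
    by (simp add: shift_simps)
next
  case (RSet a i e s)
  then show ?case
    using exec.RSet[of chk "d + a" "shift_nexp d i" "shift_rexp d e" "overlay d s0 s"]
    by (simp add: shift_simps)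
next
  case (Check k e1 e2 a i s)
  then show ?case
    using exec.Check[of chk k "shift_nexp d e1" "shift_nexp d e2" "d + a" "shift_nexp d i"
        "overlay d s0 s"]
    by (simp add: shift_simps)
next
  case (Seq c1 s1 t1 q1 s2 c2 t2 q2 s3)
  then show ?case by (simp add: exec.Seq)
next
  case (IfTrue s b c1 t q s' c2)
  then show ?case
    using exec.IfTrue[of "overlay d s0 s" "shift_test d b"] by (simp add: shift_simps)
next
  case (IfFalse s b c2 t q s' c1)
  then show ?case
    using exec.IfFalse[of "overlay d s0 s" "shift_test d b"] by (simp add: shift_simps)
next
  case (WhileFalse s b c)
  then show ?case
    using exec.WhileFalse[of "overlay d s0 s" "shift_test d b"] by (simp add: shift_simps)
next
  case (WhileTrue s1 b c t1 q1 s2 t2 q2 s3)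
  then show ?case
    using exec.WhileTrue[of "overlay d s0 s1" "shift_test d b"] by (simp add: shift_simps)
qed

section \<open>The outcome of an execution depends on few checks\<close>

text \<open>\<open>Q\<close> certifies the run: every checker that agrees on \<open>Q\<close>
  replays it step by step. A repeated check enters \<open>Q\<close> once, hence an inequality
  between \<open>card Q\<close> and \<open>q\<close>.\<close>

definition query_witness ::
  "checker \<Rightarrow> com \<Rightarrow> mem \<Rightarrow> nat \<Rightarrow> nat \<Rightarrow> mem \<Rightarrow> (check_kind \<times> nat \<times> nat) set \<Rightarrow> bool" where
  "query_witness chk c s t q s' Q \<longleftrightarrow> finite Q \<and> card Q \<le> q \<and>
     (\<forall>chk'. (\<forall>(k, i, j) \<in> Q. chk' k i j = chk k i j) \<longrightarrow> exec chk' c s t q s')"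

lemma exec_queries:
  "exec chk c s t q s' \<Longrightarrow> \<exists>Q. query_witness chk c s t q s' Q"
proof (induction rule: exec.induct)
  case (Check k e1 e2 a i s)
  have "exec chk' (Check k e1 e2 a i) s (1 + ncost e1 + ncost e2 + ncost i) 1
          (nset a (nval s i) (of_bool (chk k (nval s e1) (nval s e2))) s)"
    if "chk' k (nval s e1) (nval s e2) = chk k (nval s e1) (nval s e2)" for chk'
    using exec.Check[of chk' k e1 e2 a i s] unfolding that .
  then have "query_witness chk (Check k e1 e2 a i) s (1 + ncost e1 + ncost e2 + ncost i) 1
      (nset a (nval s i) (of_bool (chk k (nval s e1) (nval s e2))) s) {(k, nval s e1, nval s e2)}"
    unfolding query_witness_def by simp
  then show ?case by blast
next
  case (Seq c1 s1 t1 q1 s2 c2 t2 q2 s3)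
  then obtain Q1 Q2 where
    "query_witness chk c1 s1 t1 q1 s2 Q1" "query_witness chk c2 s2 t2 q2 s3 Q2" by blast
  then have "query_witness chk (Seq c1 c2) s1 (t1 + t2) (q1 + q2) s3 (Q1 \<union> Q2)"
    using card_Un_le[of Q1 Q2] by (auto simp: query_witness_def intro!: exec.Seq[where ?s2.0 = s2])
  then show ?case by blast
next
  case (WhileTrue s1 b c t1 q1 s2 t2 q2 s3)
  then obtain Q1 Q2 where
    "query_witness chk c s1 t1 q1 s2 Q1" "query_witness chk (While b c) s2 t2 q2 s3 Q2" by blast
  then have "query_witness chk (While b c) s1 (1 + tcost b + t1 + t2) (q1 + q2) s3 (Q1 \<union> Q2)"
    using card_Un_le[of Q1 Q2] WhileTrue.hyps(1)
    by (auto simp: query_witness_def simp del: plus_1_eq_Suc One_nat_def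
        intro!: exec.WhileTrue[where ?s2.0 = s2])
  then show ?case by blast
next
  case (Skip s)
  have "query_witness chk Skip s 1 0 s {}"
    by (simp add: query_witness_def exec.Skip del: One_nat_def)
  then show ?case by blast
next
  case (NSet a i e s)
  have "query_witness chk (NSet a i e) s (1 + ncost i + ncost e) 0
      (nset a (nval s i) (nval s e) s) {}"
    unfolding query_witness_def by (auto intro: exec.NSet simp del: plus_1_eq_Suc One_nat_def)
  then show ?case by blast
next
  case (RSet a i e s)
  have "query_witness chk (RSet a i e) s (1 + ncost i + rcost e) 0
      (rset a (nval s i) (rval s e) s) {}"
    unfolding query_witness_def by (auto intro: exec.RSet simp del: plus_1_eq_Suc One_nat_def)
  then show ?case by blast
next
  case (IfTrue s b c1 t q s' c2)
  then show ?case unfolding query_witness_def by (blast intro: exec.IfTrue)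
next
  case (IfFalse s b c2 t q s' c1)
  then show ?case unfolding query_witness_def by (blast intro: exec.IfFalse)
next
  case (WhileFalse s b c)
  have "query_witness chk (While b c) s (1 + tcost b) 0 s {}"
    using WhileFalse unfolding query_witness_def
    by (auto intro: exec.WhileFalse simp del: plus_1_eq_Suc One_nat_def)
  then show ?case by blast
qed

section \<open>A quadratic-time program\<close>

abbreviation RVar :: "nat \<Rightarrow> rexp" where
  "RVar a \<equiv> RGet a (NConst 0)"

abbreviation RAssign :: "nat \<Rightarrow> rexp \<Rightarrow> com" where
  "RAssign a \<equiv> RSet a (NConst 0)"

text \<open>
  Natural-number arrays: 0 is the number of answers, 1 and 2 are loop indices, 3 and 4 hold outcomes
  of checks, 5 is a flag, 6 is the number of roots found so far and 7 lists their indices. Real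
  arrays: 0 holds the weights, 1 accumulates the mass of an answer, 2 the total mass of the roots,
  3 lists the masses of the roots and 4 accumulates the entropy. Arrays from 8 on are the shifted
  memory of the program for the score.
\<close>

definition visit_pair :: com where
  "visit_pair =
     Seq (Check Implies (Var 1) (Var 2) 3 (NConst 0))
     (Seq (Check Implies (Var 2) (Var 1) 4 (NConst 0))
     (Seq (If (NEq (Var 3) (NConst 1)) (RAssign 1 (ROp RAdd (RVar 1) (RGet 0 (Var 2)))) Skip)
       (If (NEq (Var 4) (NConst 1))
         (If (NEq (Var 3) (NConst 0)) (NAssign 5 (NConst 0))
           (If (NLess (Var 2) (Var 1)) (NAssign 5 (NConst 0)) Skip))
         Skip)))"

definition record_root :: com where
  "record_root =
     If (NEq (Var 5) (NConst 1))
       (Seq (NSet 7 (Var 6) (Var 1))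
       (Seq (RSet 3 (Var 6) (RVar 1))
       (Seq (RAssign 2 (ROp RAdd (RVar 2) (RVar 1)))
         (NAssign 6 (NOp NAdd (Var 6) (NConst 1))))))
       Skip"

definition start_visit :: com where
  "start_visit = Seq (NAssign 5 (NConst 1)) (RAssign 1 (RConst 0))"

definition visit_answer :: com where
  "visit_answer = Seq start_visit (Seq (For 2 (Var 0) visit_pair) record_root)"

definition find_roots :: com where
  "find_roots = For 1 (Var 0) visit_answer"

definition add_entropy :: com where
  "add_entropy =
     (let p = ROp RDiv (RGet 3 (Var 1)) (RVar 2)
      in RAssign 4 (ROp RSub (RVar 4) (ROp RMul p (RLn p))))"

definition entropy :: com where
  "entropy = For 1 (Var 6) add_entropy"

text \<open>One flat loop runs over the cells of the matrix; row and column are recovered by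
  division and subtraction, as the machine has no remainder operation. Array 9 is array 1 of the
  shifted score program. Diagonal cells keep their initial 0, since a root can be incompatible with
  itself.\<close>

definition set_adjacency :: com where
  "set_adjacency =
     Seq (NAssign 2 (NOp NDiv (Var 1) (Var 6)))
     (Seq (NAssign 3 (NOp NSub (Var 1) (NOp NMul (Var 2) (Var 6))))
       (If (NEq (Var 2) (Var 3)) Skip
         (Check Incompat (NGet 7 (Var 2)) (NGet 7 (Var 3)) 9 (Var 1))))"

definition adjacency :: com where
  "adjacency = For 1 (NOp NMul (Var 6) (Var 6)) set_adjacency"

text \<open>After the shift by 8, array 8 is array 0 of the score program, where it expects the
  number of vertices; its result appears in the real array 8.\<close>

definition store_size :: com where
  "store_size = NAssign 8 (Var 6)"

definition store_result :: com where
  "store_result = RAssign 0 (ROp RMul (ROp RAdd (RConst 1) (RVar 8)) (RVar 4))"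

definition lgu_program :: "com \<Rightarrow> com" where
  "lgu_program Q =
     Seq find_roots (Seq entropy (Seq adjacency (Seq store_size (Seq (shift_com 8 Q) store_result))))"

section \<open>Loop invariants and correctness of the program\<close>

definition root_list :: "('a, 's) sample \<Rightarrow> nat \<Rightarrow> nat list" where
  "root_list I i = filter (root_index I) [0..<i]"

lemma root_list_0 [simp]: "root_list I 0 = []"
  by (simp add: root_list_def)

lemma root_list_Suc [simp]:
  "root_list I (Suc i) = (if root_index I i then root_list I i @ [i] else root_list I i)"
  by (simp add: root_list_def)

lemma set_root_list: "set (root_list I (num_answers I)) = root_indices I"
  by (auto simp: root_list_def root_indices_def)

lemma distinct_root_list: "distinct (root_list I i)"
  by (simp add: root_list_def)

lemma length_root_list: "length (root_list I i) \<le> i"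
  using length_filter_le[of "root_index I" "[0..<i]"] by (simp add: root_list_def)

lemma sum_list_root_list:
  "sum_list (map f (root_list I (num_answers I))) = sum f (root_indices I)"
  by (simp add: sum_list_distinct_conv_sum_set distinct_root_list set_root_list)

text \<open>Invariant of the outer loop after the first \<open>i\<close> answers. It does not
  mention the loop indices, so it survives their updates and serves the later phases too.\<close>

definition found :: "('a, 's) sample \<Rightarrow> nat \<Rightarrow> mem \<Rightarrow> bool" where
  "found I i s \<longleftrightarrow>
     nmem s 0 0 = num_answers I \<and> (\<forall>j < num_answers I. rmem s 0 j = weights I ! j) \<and>
     nmem s 6 0 = length (root_list I i) \<and>
     (\<forall>a < length (root_list I i).
        nmem s 7 a = root_list I i ! a \<and> rmem s 3 a = mass I (root_list I i ! a)) \<and>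
     rmem s 2 0 = sum_list (map (mass I) (root_list I i))"

definition unused_above :: "nat \<Rightarrow> mem \<Rightarrow> bool" where
  "unused_above d s \<longleftrightarrow> (\<forall>a \<ge> d. \<forall>x. nmem s a x = 0 \<and> rmem s a x = 0)"

text \<open>Invariant of the inner loop: the flag and the accumulator are \<open>root_index\<close>
  and \<open>mass\<close> restricted to indices below \<open>j\<close>, and they become these
  notions when \<open>j\<close> reaches the number of answers.\<close>

definition visited :: "('a, 's) sample \<Rightarrow> nat \<Rightarrow> nat \<Rightarrow> mem \<Rightarrow> bool" where
  "visited I i j s \<longleftrightarrow>
     found I i s \<and> rmem s 4 0 = 0 \<and> unused_above 8 s \<and> nmem s 1 0 = i \<and>
     nmem s 5 0 = of_bool (\<forall>j' < j. index_implies I j' i \<longrightarrow> index_implies I i j' \<and> i \<le> j') \<and>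
     rmem s 1 0 = (\<Sum>j' < j. if index_implies I i j' then weights I ! j' else 0)"

lemma answer_checker_Implies:
  "i < num_answers I \<Longrightarrow> j < num_answers I \<Longrightarrow> answer_checker I Implies i j \<longleftrightarrow> index_implies I i j"
  by (simp add: answer_checker_def index_implies_def)

lemma visit_pair_correct:
  assumes "visited I i j s" "i < num_answers I" "j < num_answers I" "nmem s 2 0 = j"
  shows "runs (answer_checker I) visit_pair s (time_bound visit_pair)
    (\<lambda>s'. nmem s' 2 0 = j \<and> visited I i (Suc j) (nset 2 0 (Suc j) s'))"
proof (rule runs_loop_free)
  show "loop_free visit_pair" by (simp add: visit_pair_def)
  show "nmem (effect (answer_checker I) visit_pair s) 2 0 = j \<and>
      visited I i (Suc j) (nset 2 0 (Suc j) (effect (answer_checker I) visit_pair s))"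
    using assms
    by (auto simp: visit_pair_def visited_def found_def unused_above_def answer_checker_Implies
        less_Suc_eq)
qed

lemma mass_eq:
  "mass I i = (\<Sum>j < num_answers I. if index_implies I i j then weights I ! j else 0)"
  using sum.inter_filter[of "{..<num_answers I}" "\<lambda>j. weights I ! j" "index_implies I i"]
  by (simp add: mass_def)

text \<open>The numbers 9 and 12 come from \<open>runs_For\<close> with the loop bound
  \<open>Var 0\<close>, whose evaluation costs 2.\<close>

definition visit_time :: "nat \<Rightarrow> nat" where
  "visit_time n =
     time_bound start_visit + (9 + n * (12 + time_bound visit_pair) + time_bound record_root)"

lemma visit_answer_correct:
  assumes "found I i s" "rmem s 4 0 = 0" "unused_above 8 s" "i < num_answers I" "nmem s 1 0 = i"
  shows "runs (answer_checker I) visit_answer s (visit_time (num_answers I))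
    (\<lambda>s'. nmem s' 1 0 = i \<and> found I (Suc i) (nset 1 0 (Suc i) s') \<and> rmem s' 4 0 = 0 \<and>
       unused_above 8 (nset 1 0 (Suc i) s'))"
    (is "runs ?chk _ _ _ ?post")
  unfolding visit_answer_def visit_time_def
proof (rule runs_Seq, rule runs_loop_free)
  show "loop_free start_visit" by (simp add: start_visit_def)
  have "visited I i 0 (nset 2 0 0 (effect ?chk start_visit s))"
    using assms by (simp add: start_visit_def visited_def found_def unused_above_def)
  then have "runs ?chk (For 2 (Var 0) visit_pair) (effect ?chk start_visit s)
      (7 + ncost (Var 0) + num_answers I * (10 + ncost (Var 0) + time_bound visit_pair))
      (\<lambda>s'. runs ?chk record_root s' (time_bound record_root) ?post)"
  proof (rule runs_For[where Inv = "visited I i"])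
    fix j s assume "visited I i j s"
    then show "nval s (Var 0) = num_answers I" by (simp add: visited_def found_def)
  next
    fix j s assume "visited I i j s" "j < num_answers I" "nmem s 2 0 = j"
    then show "runs ?chk visit_pair s (time_bound visit_pair)
        (\<lambda>s'. nmem s' 2 0 = j \<and> visited I i (Suc j) (nset 2 0 (Suc j) s'))"
      using visit_pair_correct assms by blast
  next
    fix s assume "visited I i (num_answers I) s"
    then have s: "found I i s" "rmem s 4 0 = 0" "unused_above 8 s" "nmem s 1 0 = i"
      "nmem s 5 0 = of_bool (root_index I i)" "rmem s 1 0 = mass I i"
      by (simp_all add: visited_def root_index_def mass_eq)
    show "runs ?chk record_root s (time_bound record_root) ?post"
    proof (rule runs_loop_free)
      show "loop_free record_root" by (simp add: record_root_def)
      show "?post (effect ?chk record_root s)"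
        using s
        by (auto simp: record_root_def found_def unused_above_def nth_append less_Suc_eq)
    qed
  qed
  then have "runs ?chk (For 2 (Var 0) visit_pair) (effect ?chk start_visit s)
      (9 + num_answers I * (12 + time_bound visit_pair))
      (\<lambda>s'. runs ?chk record_root s' (time_bound record_root) ?post)"
    by simp
  then show "runs ?chk (Seq (For 2 (Var 0) visit_pair) record_root) (effect ?chk start_visit s)
      (9 + num_answers I * (12 + time_bound visit_pair) + time_bound record_root) ?post"
    by (rule runs_Seq)
qed

lemma find_roots_correct:
  shows "runs (answer_checker I) find_roots (sample_mem I)
    (9 + num_answers I * (12 + visit_time (num_answers I)))
    (\<lambda>s. found I (num_answers I) s \<and> rmem s 4 0 = 0 \<and> unused_above 8 s)"
    (is "runs ?chk _ _ _ ?post")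
proof -
  let ?Inv = "\<lambda>i s. found I i s \<and> rmem s 4 0 = 0 \<and> unused_above 8 s"
  have "?Inv 0 (nset 1 0 0 (sample_mem I))"
    by (simp add: found_def unused_above_def sample_mem_def nset_def)
  then have "runs ?chk find_roots (sample_mem I)
      (7 + ncost (Var 0) + num_answers I * (10 + ncost (Var 0) + visit_time (num_answers I))) ?post"
    unfolding find_roots_def
  proof (rule runs_For[where Inv = ?Inv])
    fix i s assume "?Inv i s" "i < num_answers I" "nmem s 1 0 = i"
    then show "runs ?chk visit_answer s (visit_time (num_answers I))
        (\<lambda>s'. nmem s' 1 0 = i \<and> ?Inv (Suc i) (nset 1 0 (Suc i) s'))"
      using visit_answer_correct[of I i s] by simp
  qed (simp_all add: found_def)
  then show ?thesis by simp
qed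

lemma entropy_correct:
  assumes "found I (num_answers I) s" "rmem s 4 0 = 0" "unused_above 8 s"
  shows "runs (answer_checker I) entropy s (9 + num_answers I * (12 + time_bound add_entropy))
    (\<lambda>s. found I (num_answers I) s \<and> rmem s 4 0 = IGE I \<and> unused_above 8 s)"
    (is "runs ?chk _ _ _ ?post")
proof -
  let ?rs = "root_list I (num_answers I)"
  let ?h = "\<lambda>i. index_prob I i * ln (index_prob I i)"
  let ?Inv = "\<lambda>a s. found I (num_answers I) s \<and> unused_above 8 s \<and>
    rmem s 4 0 = - (\<Sum>a' < a. ?h (?rs ! a'))"
  have "?Inv 0 (nset 1 0 0 s)"
    using assms by (simp add: found_def unused_above_def)
  then have "runs ?chk entropy s
      (7 + ncost (Var 6) + length ?rs * (10 + ncost (Var 6) + time_bound add_entropy)) ?post"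
    unfolding entropy_def
  proof (rule runs_For[where Inv = ?Inv])
    fix a s assume s: "?Inv a s" "a < length ?rs" "nmem s 1 0 = a"
    have total: "rmem s 2 0 = (\<Sum>j \<in> root_indices I. mass I j)"
      using s by (simp add: found_def sum_list_root_list)
    show "runs ?chk add_entropy s (time_bound add_entropy)
        (\<lambda>s'. nmem s' 1 0 = a \<and> ?Inv (Suc a) (nset 1 0 (Suc a) s'))"
    proof (rule runs_loop_free)
      show "loop_free add_entropy" by (simp add: add_entropy_def Let_def)
      show "nmem (effect ?chk add_entropy s) 1 0 = a \<and>
          ?Inv (Suc a) (nset 1 0 (Suc a) (effect ?chk add_entropy s))"
        using s total
        by (auto simp: add_entropy_def Let_def found_def unused_above_def index_prob_def)
    qed
  next
    fix s assume "?Inv (length ?rs) s"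
    then show "?post s"
      using sum_list_root_list[of ?h I]
      by (simp add: IGE_eq sum_list_sum_nth atLeast0LessThan)
  qed (simp_all add: found_def)
  then show ?thesis
    by (rule runs_mono) (simp_all add: length_root_list)
qed

definition adjacency_entry :: "('a, 's) sample \<Rightarrow> nat \<Rightarrow> bool" where
  "adjacency_entry I x \<longleftrightarrow>
     (let rs = root_list I (num_answers I); k = length rs
      in (cluster_of I (rs ! (x div k)), cluster_of I (rs ! (x mod k))) \<in> parcs (InG I))"

definition tabulated :: "('a, 's) sample \<Rightarrow> nat \<Rightarrow> mem \<Rightarrow> bool" where
  "tabulated I x s \<longleftrightarrow>
     found I (num_answers I) s \<and> rmem s 4 0 = IGE I \<and>
     (\<forall>a \<ge> 8. \<forall>y. rmem s a y = 0 \<and>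
        nmem s a y = (if a = 9 \<and> y < x then of_bool (adjacency_entry I y) else 0))"

lemma set_adjacency_correct:
  assumes "tabulated I x s" "x < length (root_list I (num_answers I)) ^ 2" "nmem s 1 0 = x"
  shows "runs (answer_checker I) set_adjacency s (time_bound set_adjacency)
    (\<lambda>s'. nmem s' 1 0 = x \<and> tabulated I (Suc x) (nset 1 0 (Suc x) s'))"
proof (rule runs_loop_free)
  show "loop_free set_adjacency" by (simp add: set_adjacency_def)
  let ?rs = "root_list I (num_answers I)"
  define k where "k = length ?rs"
  have "0 < k" using assms(2) by (cases k) (auto simp: k_def)
  have a: "x div k < k" using assms(2) by (simp add: k_def power2_eq_square less_mult_imp_div_less)
  have b: "x mod k < k" using \<open>0 < k\<close> by simp
  have diff: "x - x div k * k = x mod k" by (simp add: minus_div_mult_eq_mod)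
  have roots: "?rs ! (x div k) \<in> root_indices I" "?rs ! (x mod k) \<in> root_indices I"
    using a b nth_mem[of _ ?rs] by (auto simp: k_def set_root_list)
  have neq: "?rs ! (x div k) = ?rs ! (x mod k) \<longleftrightarrow> x div k = x mod k"
    using a b by (simp add: k_def nth_eq_iff_index_eq distinct_root_list)
  have entry: "adjacency_entry I x \<longleftrightarrow> x div k \<noteq> x mod k \<and>
      answer_checker I Incompat (?rs ! (x div k)) (?rs ! (x mod k))"
    using roots neq
    by (auto simp: adjacency_entry_def Let_def k_def[symmetric] mem_parcs_InG_iff
        answer_checker_def root_indices_def)
  have mem: "nmem s 6 0 = k" "nmem s 7 (x div k) = ?rs ! (x div k)"
    "nmem s 7 (x mod k) = ?rs ! (x mod k)"
    using assms a b by (auto simp: tabulated_def found_def k_def)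
  show "nmem (effect (answer_checker I) set_adjacency s) 1 0 = x \<and>
      tabulated I (Suc x) (nset 1 0 (Suc x) (effect (answer_checker I) set_adjacency s))"
    using assms(1,3) entry mem diff
    by (auto simp: set_adjacency_def tabulated_def found_def less_Suc_eq)
qed

lemma adjacency_correct:
  assumes "found I (num_answers I) s" "rmem s 4 0 = IGE I" "unused_above 8 s"
  shows "runs (answer_checker I) adjacency s
    (12 + num_answers I ^ 2 * (15 + time_bound set_adjacency))
    (tabulated I (length (root_list I (num_answers I)) ^ 2))"
proof -
  let ?k = "length (root_list I (num_answers I))"
  let ?e = "NOp NMul (Var 6) (Var 6)"
  have "tabulated I 0 (nset 1 0 0 s)"
    using assms by (auto simp: tabulated_def found_def unused_above_def)
  then have "runs (answer_checker I) adjacency s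
      (7 + ncost ?e + ?k ^ 2 * (10 + ncost ?e + time_bound set_adjacency)) (tabulated I (?k ^ 2))"
    unfolding adjacency_def
  proof (rule runs_For[where Inv = "tabulated I"])
    fix x s assume "tabulated I x s"
    then show "nval s ?e = ?k ^ 2" by (simp add: tabulated_def found_def power2_eq_square)
  qed (rule set_adjacency_correct)
  then show ?thesis
    by (rule runs_mono) (simp_all add: power_mono length_root_list)
qed

text \<open>\<open>exec_shift\<close> needs an equality of whole memories. This is why
  \<open>tabulated\<close> prescribes every cell of the arrays from 8 on and not only the
  matrix.\<close>

lemma tabulated_eq_overlay:
  assumes "tabulated I (length (root_list I (num_answers I)) ^ 2) s"
  defines "vs \<equiv> map (cluster_of I) (root_list I (num_answers I))"
  shows "nset 8 0 (length vs) s = overlay 8 s (graph_mem (InG I) vs)"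
proof -
  let ?k = "length (root_list I (num_answers I))"
  have nth: "vs ! (y div ?k) = cluster_of I (root_list I (num_answers I) ! (y div ?k))"
    "vs ! (y mod ?k) = cluster_of I (root_list I (num_answers I) ! (y mod ?k))"
    if "y < ?k * ?k" for y
  proof -
    have "0 < ?k" using that by (cases ?k) auto
    then show "vs ! (y mod ?k) = cluster_of I (root_list I (num_answers I) ! (y mod ?k))"
      by (simp add: vs_def)
    show "vs ! (y div ?k) = cluster_of I (root_list I (num_answers I) ! (y div ?k))"
      using that by (simp add: vs_def less_mult_imp_div_less)
  qed
  have "nmem (nset 8 0 (length vs) s) a y = nmem (overlay 8 s (graph_mem (InG I) vs)) a y" for a y
    using assms(1) nth
    by (auto simp: tabulated_def overlay_def graph_mem_def adjacency_entry_def Let_def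
        power2_eq_square vs_def le_imp_diff_is_add)
  moreover have "rmem (nset 8 0 (length vs) s) a y = rmem (overlay 8 s (graph_mem (InG I) vs)) a y"
    for a y
    using assms(1) by (auto simp: tabulated_def overlay_def graph_mem_def Let_def)
  ultimately show ?thesis by (simp add: mem.equality fun_eq_iff)
qed

text \<open>The score program runs on some number of roots up to \<open>n\<close>, and
  \<open>T\<close> is not assumed monotone; hence the maximum.\<close>

definition lgu_time :: "(nat \<Rightarrow> nat) \<Rightarrow> nat \<Rightarrow> nat" where
  "lgu_time T n =
     (9 + n * (12 + visit_time n)) + ((9 + n * (12 + time_bound add_entropy)) +
     ((12 + n ^ 2 * (15 + time_bound set_adjacency)) + (time_bound store_size +
     (Max (T ` {..n}) + time_bound store_result))))"

lemma lgu_program_correct: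
  fixes InS :: "'a set pair_pre_digraph \<Rightarrow> real" and I :: "('a, 's) sample"
  assumes score: "\<And>G vs. pair_digraph G \<Longrightarrow> distinct vs \<Longrightarrow> set vs = pverts G \<Longrightarrow>
    \<exists>t s'. exec (\<lambda>_ _ _. False) Q (graph_mem G vs) t 0 s' \<and> t \<le> T (length vs) \<and> rmem s' 0 0 = InS G"
  shows "runs (answer_checker I) (lgu_program Q) (sample_mem I) (lgu_time T (num_answers I))
    (\<lambda>s. rmem s 0 0 = LGU InS I)"
    (is "runs ?chk _ _ _ ?post")
proof -
  let ?n = "num_answers I"
  let ?rs = "root_list I ?n"
  define vs where "vs = map (cluster_of I) ?rs"
  have vs: "distinct vs" "set vs = pverts (InG I)"
    using inj_on_cluster_of[of I]
    by (simp_all add: vs_def distinct_map distinct_root_list set_root_list InG_def roots_eq)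
  from score[OF pair_digraph_InG this] obtain t s' where
    Q: "exec (\<lambda>_ _ _. False) Q (graph_mem (InG I) vs) t 0 s'" "t \<le> T (length vs)"
      "rmem s' 0 0 = InS (InG I)" by blast
  \<comment> \<open>A run without checks has an empty witness set, so it is a run under every
    checker.\<close>
  have "exec ?chk Q (graph_mem (InG I) vs) t 0 s'"
    using exec_queries[OF Q(1)] by (auto simp: query_witness_def)
  note Q_shifted = exec_shift[OF this, of 8]
  have "length vs \<le> ?n" by (simp add: vs_def length_root_list)
  then have "T (length vs) \<le> Max (T ` {..?n})" by (intro Max_ge) auto
  with Q(2) have t: "t \<le> Max (T ` {..?n})" by simp
  have run_Q: "runs ?chk (shift_com 8 Q) (effect ?chk store_size s) (Max (T ` {..?n}))
      (\<lambda>s. runs ?chk store_result s (time_bound store_result) ?post)"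
    if s: "tabulated I (length ?rs ^ 2) s" for s
  proof (rule runsI[OF _ t])
    have "effect ?chk store_size s = overlay 8 s (graph_mem (InG I) vs)"
      using s tabulated_eq_overlay[OF s]
      by (simp add: store_size_def vs_def tabulated_def found_def)
    then show "exec ?chk (shift_com 8 Q) (effect ?chk store_size s) t 0 (overlay 8 s s')"
      using Q_shifted by simp
    show "runs ?chk store_result (overlay 8 s s') (time_bound store_result) ?post"
      by (rule runs_loop_free)
        (use s Q(3) in \<open>simp_all add: store_result_def overlay_def tabulated_def LGU_def\<close>)
  qed
  show ?thesis
    unfolding lgu_program_def lgu_time_def
    by (intro runs_Seq runs_mono[OF find_roots_correct order_refl]
        runs_mono[OF entropy_correct order_refl] runs_mono[OF adjacency_correct order_refl]
        runs_loop_free run_Q)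
      (auto simp: store_size_def)
qed

section \<open>Asymptotics of the running time\<close>

lemma Max_bigo_power2:
  fixes T :: "nat \<Rightarrow> nat"
  assumes "(\<lambda>n. real (T n)) \<in> O(\<lambda>n. real n ^ 2)"
  shows "(\<lambda>n. real (Max (T ` {..n}))) \<in> O(\<lambda>n. real n ^ 2)"
proof -
  obtain c N where c: "c > 0" "\<And>n. n \<ge> N \<Longrightarrow> real (T n) \<le> c * real n ^ 2"
    using assms by (elim landau_o.bigE) (auto simp: eventually_sequentially)
  \<comment> \<open>Sizes below \<open>N\<close>, where the asymptotic estimate may fail, are
    bounded by the constant \<open>D\<close>, which is absorbed because \<open>n ^ 2\<close> is at
    least 1.\<close>
  define D where "D = real (Max (T ` {..N}))"
  have "real (T m) \<le> (c + D) * real n ^ 2" if "n \<ge> 1" "m \<le> n" for m n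
  proof (cases "m \<ge> N")
    case True
    have "real (T m) \<le> c * real m ^ 2" using c True by simp
    also have "\<dots> \<le> c * real n ^ 2" using c that by (simp add: power_mono)
    also have "\<dots> \<le> (c + D) * real n ^ 2" by (simp add: D_def mult_right_mono)
    finally show ?thesis .
  next
    case False
    then have "real (T m) \<le> D" by (simp add: D_def)
    also have "\<dots> \<le> D * real n ^ 2" using that by (simp add: D_def mult_le_cancel_left1)
    also have "\<dots> \<le> (c + D) * real n ^ 2" using c by (simp add: mult_right_mono)
    finally show ?thesis .
  qed
  moreover have "Max (T ` {..n}) \<in> T ` {..n}" for n by (intro Max_in) auto
  ultimately have "real (Max (T ` {..n})) \<le> (c + D) * real n ^ 2" if "n \<ge> 1" for n
    using that by (metis (no_types, lifting) atMost_iff imageE)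
  then show ?thesis
    by (intro bigoI[of _ "c + D"]) (auto simp: eventually_sequentially intro!: exI[of _ 1])
qed

lemma lgu_time_bigo:
  assumes "(\<lambda>n. real (T n)) \<in> O(\<lambda>n. real n ^ 2)"
  shows "(\<lambda>n. real (lgu_time T n)) \<in> O(\<lambda>n. real n ^ 2)"
proof -
  have quadratic: "(\<lambda>n. a + b * real n + c * real n ^ 2) \<in> O(\<lambda>n. real n ^ 2)" for a b c
  proof -
    have "\<bar>a + b * real n + c * real n ^ 2\<bar> \<le> (\<bar>a\<bar> + \<bar>b\<bar> + \<bar>c\<bar>) * real n ^ 2" if "n \<ge> 1" for n
    proof -
      have "1 \<le> real n ^ 2" "real n \<le> real n ^ 2" using that by (simp_all add: self_le_power)
      then have "\<bar>a\<bar> * 1 \<le> \<bar>a\<bar> * real n ^ 2" "\<bar>b\<bar> * real n \<le> \<bar>b\<bar> * real n ^ 2"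
        by (intro mult_left_mono; simp)+
      moreover have "\<bar>a + b * real n + c * real n ^ 2\<bar> \<le> \<bar>a\<bar> + \<bar>b\<bar> * real n + \<bar>c\<bar> * real n ^ 2"
        by (intro order_trans[OF abs_triangle_ineq] add_mono) (simp_all add: abs_mult)
      ultimately show ?thesis by (simp add: distrib_right)
    qed
    then show ?thesis
      by (intro bigoI[of _ "\<bar>a\<bar> + \<bar>b\<bar> + \<bar>c\<bar>"]) (auto simp: eventually_sequentially intro!: exI[of _ 1])
  qed
  \<comment> \<open>\<open>a\<close>, \<open>b\<close> and \<open>c\<close> are the coefficients of
    1, \<open>n\<close> and \<open>n ^ 2\<close> in the expanded \<open>lgu_time\<close>, leaving
    the maximum as the only other term.\<close>
  define a where "a = 30 + time_bound store_size + time_bound store_result"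
  define b where
    "b = 33 + time_bound start_visit + time_bound record_root + time_bound add_entropy"
  define c where "c = 27 + time_bound visit_pair + time_bound set_adjacency"
  have "real (lgu_time T n) =
      (real a + real b * real n + real c * real n ^ 2) + real (Max (T ` {..n}))" for n
    by (simp add: lgu_time_def visit_time_def a_def b_def c_def algebra_simps power2_eq_square)
  then show ?thesis
    by (simp only:) (intro sum_in_bigo quadratic Max_bigo_power2 assms)
qed

section \<open>The adversary for the lower bound\<close>

lemma mass_nonneg:
  assumes "valid_sample I"
  shows "0 \<le> mass I i"
  using assms
  by (auto simp: valid_sample_def num_answers_def mass_def intro!: sum_nonneg)

lemma IGE_eq_0:
  assumes "a \<in> root_indices I" "\<And>i. i \<in> root_indices I \<Longrightarrow> i \<noteq> a \<Longrightarrow> mass I i = 0"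
  shows "IGE I = 0"
proof -
  have "(\<Sum>i \<in> root_indices I. mass I i) = mass I a"
    using assms by (subst sum.remove[OF finite_root_indices assms(1)]) simp
  \<comment> \<open>Three cases vanish: \<open>1 * ln 1\<close> at \<open>a\<close>,
    \<open>0 * ln 0\<close> at the other roots, and everything when the total mass is 0, where
    division yields 0.\<close>
  then have "index_prob I i * ln (index_prob I i) = 0" if "i \<in> root_indices I" for i
    using assms(2)[OF that] by (cases "i = a"; cases "mass I a = 0") (auto simp: index_prob_def)
  then have "(\<Sum>i \<in> root_indices I. index_prob I i * ln (index_prob I i)) = 0"
    by (intro sum.neutral ballI)
  then show ?thesis by (simp add: IGE_eq)
qed

text \<open>All terms of the entropy are nonnegative for probabilities in [0, 1]. The mass of
  \<open>b\<close> keeps the probability of \<open>a\<close> strictly below 1, so the term of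
  \<open>a\<close> is positive.\<close>

lemma IGE_pos:
  assumes "valid_sample I" "a \<in> root_indices I" "b \<in> root_indices I" "a \<noteq> b"
    and "0 < mass I a" "0 < mass I b"
  shows "0 < IGE I"
proof -
  let ?M = "\<Sum>i \<in> root_indices I. mass I i"
  let ?h = "\<lambda>i. - (index_prob I i * ln (index_prob I i))"
  have le: "mass I i \<le> ?M" if "i \<in> root_indices I" for i
    using that assms(1) by (intro member_le_sum) (auto simp: mass_nonneg finite_root_indices)
  have "mass I a + mass I b = (\<Sum>i \<in> {a, b}. mass I i)" using assms(4) by simp
  also have "\<dots> \<le> ?M"
    using assms by (intro sum_mono2) (auto simp: mass_nonneg finite_root_indices)
  finally have lt: "mass I a < ?M" "0 < ?M" using assms by simp_all
  have "0 < (\<Sum>i \<in> root_indices I. ?h i)"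
  proof (rule sum_pos2[OF finite_root_indices assms(2)])
    have "0 < index_prob I a" "index_prob I a < 1"
      using lt assms(5) by (simp_all add: index_prob_def)
    then show "0 < ?h a" by (simp add: mult_pos_neg)
  next
    fix i assume "i \<in> root_indices I"
    then have "0 \<le> index_prob I i" "index_prob I i \<le> 1"
      using le lt mass_nonneg[OF assms(1)] by (simp_all add: index_prob_def)
    then show "0 \<le> ?h i"
      by (cases "index_prob I i = 0") (simp_all add: mult_nonneg_nonpos)
  qed
  then show ?thesis by (simp add: IGE_eq sum_negf)
qed

text \<open>
  Answers realizing a prescribed strict order: answer \<open>x\<close> holds in the common situation \<open>g 0\<close>, which
  rules out incompatibilities, and in the situations \<open>g (Suc y)\<close> for all \<open>y\<close> implying it.
\<close>

definition order_sample ::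
  "(nat \<Rightarrow> 'a) \<Rightarrow> (nat \<Rightarrow> 's) \<Rightarrow> (nat \<times> nat) set \<Rightarrow> real list \<Rightarrow> ('a, 's) sample" where
  "order_sample f g R ws =
     \<lparr> situations = UNIV,
       holds = (\<lambda>a s. \<exists>x. a = f x \<and> (s = g 0 \<or> (\<exists>y. s = g (Suc y) \<and> (y, x) \<in> R\<^sup>=))),
       answers = map f [0..<length ws],
       weights = ws \<rparr>"

lemma num_answers_order_sample [simp]: "num_answers (order_sample f g R ws) = length ws"
  by (simp add: order_sample_def num_answers_def)

lemma weights_order_sample [simp]: "weights (order_sample f g R ws) = ws"
  by (simp add: order_sample_def)

text \<open>The initial memory contains only the number of answers and the weights, so a program can
  learn about the order only through checks.\<close>

lemma sample_mem_order_sample: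
  "sample_mem (order_sample f g R ws) = sample_mem (order_sample f g R' ws)"
  by (auto simp: sample_mem_def fun_eq_iff)

lemma index_implies_order_sample:
  assumes "inj f" "inj g" "trans R" "i < length ws" "j < length ws"
  shows "index_implies (order_sample f g R ws) i j \<longleftrightarrow> (i, j) \<in> R\<^sup>="
proof -
  let ?I = "order_sample f g R ws"
  have holds: "holds ?I (f x) s \<longleftrightarrow> s = g 0 \<or> (\<exists>y. s = g (Suc y) \<and> (y, x) \<in> R\<^sup>=)" for x s
    using assms(1) by (auto simp: order_sample_def inj_eq)
  have "implies ?I (f i) (f j) \<longleftrightarrow> (i, j) \<in> R\<^sup>="
  proof
    assume "implies ?I (f i) (f j)"
    then have "holds ?I (f i) s \<longrightarrow> holds ?I (f j) s" for s
      by (simp add: implies_def order_sample_def)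
    \<comment> \<open>In the situation \<open>g (Suc i)\<close> answer \<open>i\<close> holds,
      together with precisely those answers that \<open>R\<close> places after it.\<close>
    from this[of "g (Suc i)"] show "(i, j) \<in> R\<^sup>="
      using assms(2) by (auto simp: holds inj_eq)
  next
    assume "(i, j) \<in> R\<^sup>="
    then show "implies ?I (f i) (f j)"
      using assms(3) unfolding implies_def holds by (blast dest: transD)
  qed
  then show ?thesis using assms(4,5) by (simp add: index_implies_def order_sample_def)
qed

text \<open>Antisymmetry reduces equivalence to equality of indices, and the common situation
  \<open>g 0\<close> makes every incompatibility check fail. Only the implication checks thus carry
  information about \<open>R\<close>.\<close>

lemma answer_checker_order_sample:
  assumes "inj f" "inj g" "trans R" "antisym R"
  shows "answer_checker (order_sample f g R ws) k i j \<longleftrightarrow>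
    i < length ws \<and> j < length ws \<and>
    (case k of Equiv \<Rightarrow> i = j | Implies \<Rightarrow> (i, j) \<in> R\<^sup>= | Incompat \<Rightarrow> False)"
proof (cases "i < length ws \<and> j < length ws")
  case True
  let ?I = "order_sample f g R ws"
  have "\<not> incompatible ?I (answers ?I ! i) (answers ?I ! j)"
    using True by (auto simp: incompatible_def order_sample_def)
  then show ?thesis
    using True assms
    by (auto simp: answer_checker_def equivalent_def index_implies_def[symmetric]
        index_implies_order_sample antisym_def split: check_kind.split)
qed (auto simp: answer_checker_def)

lemma root_indices_order_sample:
  assumes "inj f" "inj g" "trans R" "irrefl R"
  shows "root_indices (order_sample f g R ws) = {i. i < length ws \<and> (\<forall>j < length ws. (j, i) \<notin> R)}"
proof -
  have "(i, j) \<notin> R" if "(j, i) \<in> R" for i j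
    using assms(3,4) that by (auto simp: irrefl_def dest: transD)
  then show ?thesis
    using assms
    by (auto simp: root_indices_def root_index_def index_implies_order_sample irrefl_def)
qed

text \<open>
  Answer \<open>0\<close> is the only answer above the answers \<open>1, \<dots>, n - m - 1\<close>, all of positive weight; the
  answers \<open>n - m, \<dots>, n - 1\<close> have weight zero and are above nothing, apart from the pairs in \<open>E\<close>.
\<close>

definition fan_weights :: "nat \<Rightarrow> nat \<Rightarrow> real list" where
  "fan_weights n m = map (\<lambda>i. if i < n - m then 1 / real (n - m) else 0) [0..<n]"

definition fan :: "nat \<Rightarrow> nat \<Rightarrow> (nat \<times> nat) set \<Rightarrow> (nat \<times> nat) set" where
  "fan n m E = {0} \<times> {1..<n - m} \<union> E"

text \<open>The relation is bipartite: no target of a pair is the source of another, so there are no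
  chains of two pairs and all three properties follow.\<close>

lemma fan_order:
  assumes "m < n" "E \<subseteq> {n - m..<n} \<times> {1..<n - m}"
  shows "trans (fan n m E)" "antisym (fan n m E)" "irrefl (fan n m E)"
proof -
  have "\<exists>U. fan n m E \<subseteq> U \<times> - U"
    using assms by (intro exI[of _ "insert 0 {n - m..<n}"]) (auto simp: fan_def)
  then show "trans (fan n m E)" "antisym (fan n m E)" "irrefl (fan n m E)"
    by (auto simp: trans_def antisym_def irrefl_def)
qed

lemma valid_fan:
  assumes "m < n"
  shows "valid_sample (order_sample f g R (fan_weights n m))"
proof -
  have "sum_list (fan_weights n m) = (\<Sum>i < n. if i < n - m then 1 / real (n - m) else 0)"
    by (simp add: fan_weights_def sum_list_sum_nth atLeast0LessThan)
  also have "\<dots> = (\<Sum>i < n - m. 1 / real (n - m))"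
    by (rule sum.mono_neutral_cong_right) auto
  also have "\<dots> = 1" using assms by simp
  finally show ?thesis
    by (auto simp: valid_sample_def order_sample_def fan_weights_def)
qed

lemma length_fan_weights [simp]: "length (fan_weights n m) = n"
  by (simp add: fan_weights_def)

lemma root_indices_fan:
  assumes "inj f" "inj g" "m < n" "E \<subseteq> {n - m..<n} \<times> {1..<n - m}"
  shows "root_indices (order_sample f g (fan n m E) (fan_weights n m)) = insert 0 {n - m..<n}"
  using assms fan_order[OF assms(3,4)]
  by (auto simp: root_indices_order_sample fan_def not_less_eq_eq)

lemma mass_fan:
  assumes "inj f" "inj g" "m < n" "E \<subseteq> {n - m..<n} \<times> {1..<n - m}" "i < n"
  shows "mass (order_sample f g (fan n m E) (fan_weights n m)) i =
    (\<Sum>j | j < n - m \<and> (i, j) \<in> (fan n m E)\<^sup>=. 1 / real (n - m))"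
proof -
  have "mass (order_sample f g (fan n m E) (fan_weights n m)) i =
      (\<Sum>j | j < n \<and> (i, j) \<in> (fan n m E)\<^sup>=. fan_weights n m ! j)"
    unfolding mass_def using assms fan_order[OF assms(3,4)]
    by (intro sum.cong) (auto simp: index_implies_order_sample)
  also have "\<dots> = (\<Sum>j | j < n - m \<and> (i, j) \<in> (fan n m E)\<^sup>=. 1 / real (n - m))"
    by (rule sum.mono_neutral_cong_right) (auto simp: fan_weights_def)
  finally show ?thesis .
qed

lemma IGE_fan:
  assumes "inj f" "inj g" "m < n"
  shows "IGE (order_sample f g (fan n m {}) (fan_weights n m)) = 0"
proof (rule IGE_eq_0)
  show "0 \<in> root_indices (order_sample f g (fan n m {}) (fan_weights n m))"
    using assms by (simp add: root_indices_fan)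
  fix i assume "i \<in> root_indices (order_sample f g (fan n m {}) (fan_weights n m))" "i \<noteq> 0"
  then have i: "n - m \<le> i" "i < n" using assms by (simp_all add: root_indices_fan)
  then have "{j. j < n - m \<and> (i, j) \<in> (fan n m {})\<^sup>=} = {}" using assms by (auto simp: fan_def)
  then show "mass (order_sample f g (fan n m {}) (fan_weights n m)) i = 0"
    unfolding mass_fan[OF assms empty_subsetI i(2)] by (simp only: sum.empty)
qed

lemma IGE_fan_insert:
  assumes "inj f" "inj g" "m < n" "p \<in> {n - m..<n}" "q \<in> {1..<n - m}"
  shows "0 < IGE (order_sample f g (fan n m {(p, q)}) (fan_weights n m))"
proof (rule IGE_pos)
  let ?I = "order_sample f g (fan n m {(p, q)}) (fan_weights n m)"
  have E: "{(p, q)} \<subseteq> {n - m..<n} \<times> {1..<n - m}" using assms(4,5) by simp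
  show "0 \<in> root_indices ?I" "p \<in> root_indices ?I" "0 \<noteq> p"
    using assms(3-5) unfolding root_indices_fan[OF assms(1-3) E] by auto
  show "valid_sample ?I" using assms(3) by (rule valid_fan)
  have pos: "0 < mass ?I i" if "i < n" "j < n - m" "(i, j) \<in> (fan n m {(p, q)})\<^sup>=" for i j
    unfolding mass_fan[OF assms(1-3) E that(1)]
    by (rule sum_pos) (use that assms(3) in auto)
  show "0 < mass ?I 0" using assms(3) by (intro pos[of 0 0]) auto
  show "0 < mass ?I p" using assms(4,5) by (intro pos[of p q]) (auto simp: fan_def)
qed

text \<open>The bound counts pairs of one of the \<open>m\<close> weightless answers and one of the
  \<open>n - m - 1\<close> weighted answers other than \<open>0\<close>; each pair forces a check of
  its own. The infinite types supply enough distinct answers and situations for every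
  \<open>n\<close>.\<close>

lemma many_checks:
  fixes InS :: "'a set pair_pre_digraph \<Rightarrow> real"
  assumes "infinite (UNIV :: 'a set)" "infinite (UNIV :: 's set)"
    and nonneg: "\<And>G. pair_digraph G \<Longrightarrow> 0 \<le> InS G"
    and correct: "\<And>I :: ('a, 's) sample. valid_sample I \<Longrightarrow> \<exists>t q. computes_LGU InS P I t q"
    and "m < n"
  shows "\<exists>I :: ('a, 's) sample. valid_sample I \<and> num_answers I = n \<and>
    (\<exists>t q. computes_LGU InS P I t q \<and> m * (n - m - 1) \<le> q)"
proof -
  obtain f :: "nat \<Rightarrow> 'a" where f: "inj f"
    using assms(1) infinite_iff_countable_subset[of "UNIV :: 'a set"] by blast
  obtain g :: "nat \<Rightarrow> 's" where g: "inj g"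
    using assms(2) infinite_iff_countable_subset[of "UNIV :: 's set"] by blast
  define I where "I E = order_sample f g (fan n m E) (fan_weights n m)" for E
  let ?pairs = "{n - m..<n} \<times> {1..<n - m}"
  have valid: "valid_sample (I E)" for E using \<open>m < n\<close> by (simp add: I_def valid_fan)
  obtain t q s where base: "exec (answer_checker (I {})) P (sample_mem (I {})) t q s"
    and "rmem s 0 0 = LGU InS (I {})"
    using correct[OF valid[of "{}"]] unfolding computes_LGU_def by blast
  then have result: "rmem s 0 0 = 0" using f g \<open>m < n\<close> by (simp add: LGU_def I_def IGE_fan)
  obtain Q where Q: "finite Q" "card Q \<le> q"
    and replay: "\<And>chk. (\<forall>(k, i, j) \<in> Q. chk k i j = answer_checker (I {}) k i j) \<Longrightarrow>
      exec chk P (sample_mem (I {})) t q s"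
    using exec_queries[OF base] unfolding query_witness_def by blast
  have "(Implies, i, j) \<in> Q" if "(i, j) \<in> ?pairs" for i j
  proof (rule ccontr)
    assume "(Implies, i, j) \<notin> Q"
    with that have ij: "(i, j) \<in> ?pairs" "(Implies, i, j) \<notin> Q" by blast+
    then have E: "{(i, j)} \<subseteq> ?pairs" by simp
    \<comment> \<open>The enlarged relation is still transitive and antisymmetric, so the new pair
      creates no further implication and no equivalence.\<close>
    have agree: "answer_checker (I {(i, j)}) k i' j' = answer_checker (I {}) k i' j'"
      if "(k, i', j') \<noteq> (Implies, i, j)" for k i' j'
      using that f g fan_order[OF \<open>m < n\<close> E] fan_order[OF \<open>m < n\<close> empty_subsetI]
      by (auto simp: I_def answer_checker_order_sample fan_def split: check_kind.split)
    \<comment> \<open>The base run avoids the only altered check, so it is also the run on the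
      altered sample. By determinism the program returns 0 there, although the LGU is
      positive.\<close>
    have "exec (answer_checker (I {(i, j)})) P (sample_mem (I {})) t q s"
    proof (intro replay ballI, clarify)
      fix k i' j' assume "(k, i', j') \<in> Q"
      then show "answer_checker (I {(i, j)}) k i' j' = answer_checker (I {}) k i' j'"
        using ij(2) by (intro agree) auto
    qed
    then have 1: "exec (answer_checker (I {(i, j)})) P (sample_mem (I {(i, j)})) t q s"
      unfolding I_def by (subst sample_mem_order_sample)
    obtain t' q' s' where 2: "exec (answer_checker (I {(i, j)})) P (sample_mem (I {(i, j)})) t' q' s'"
      and result': "rmem s' 0 0 = LGU InS (I {(i, j)})"
      using correct[OF valid] unfolding computes_LGU_def by blast
    have "0 < LGU InS (I {(i, j)})"
      using nonneg[OF pair_digraph_InG] IGE_fan_insert[OF f g \<open>m < n\<close>, of i j] ij(1)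
      unfolding LGU_def I_def by (intro mult_pos_pos add_pos_nonneg) auto
    then show False using exec_deterministic[OF 1 2] result result' by simp
  qed
  then have "card ((\<lambda>(i, j). (Implies, i, j)) ` ?pairs) \<le> card Q"
    by (intro card_mono[OF Q(1)]) auto
  moreover have "card ((\<lambda>(i, j). (Implies, i, j)) ` ?pairs) = m * (n - m - 1)"
    using \<open>m < n\<close> by (subst card_image) (auto simp: inj_on_def card_cartesian_product)
  ultimately have "m * (n - m - 1) \<le> q" using Q(2) by simp
  moreover have "computes_LGU InS P (I {}) t q"
    using base \<open>rmem s 0 0 = LGU InS (I {})\<close> unfolding computes_LGU_def by blast
  moreover have "num_answers (I {}) = n" by (simp add: I_def)
  ultimately show ?thesis using valid by blast
qed

lemma half_power2_bigomega: "(\<lambda>n. real (((n - 1) div 2) ^ 2)) \<in> \<Omega>(\<lambda>n. real n ^ 2)"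
proof -
  \<comment> \<open>The constant is the square of 1/4, from
    \<open>n \<le> 4 * ((n - 1) div 2)\<close>.\<close>
  have "1 / 16 * real n ^ 2 \<le> real (((n - 1) div 2) ^ 2)" if "n \<ge> 4" for n
  proof -
    have "n \<le> 4 * ((n - 1) div 2)" using that by presburger
    then have "real n \<le> 4 * real ((n - 1) div 2)" by linarith
    then have "real n ^ 2 \<le> (4 * real ((n - 1) div 2)) ^ 2" by (intro power_mono) auto
    then show ?thesis by (simp add: power_mult_distrib)
  qed
  then show ?thesis
    by (intro landau_omega.bigI[of "1 / 16"]) (auto simp: eventually_sequentially)
qed

theorem theorem7:
  fixes InS :: "'a set pair_pre_digraph \<Rightarrow> real"
  assumes "infinite (UNIV :: 'a set)" and "infinite (UNIV :: 's set)"
    and "\<And>G. pair_digraph G \<Longrightarrow> 0 \<le> InS G"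
    and "quadratic_time_score InS"
  shows
    "(\<exists>P (T :: nat \<Rightarrow> nat). (\<lambda>n. real (T n)) \<in> O(\<lambda>n. real n ^ 2) \<and>
        (\<forall>I :: ('a, 's) sample. valid_sample I \<longrightarrow>
           (\<exists>t q. computes_LGU InS P I t q \<and> t \<le> T (num_answers I)))) \<and>
     (\<forall>P. (\<forall>I :: ('a, 's) sample. valid_sample I \<longrightarrow> (\<exists>t q. computes_LGU InS P I t q)) \<longrightarrow>
        (\<exists>T :: nat \<Rightarrow> nat. (\<lambda>n. real (T n)) \<in> \<Omega>(\<lambda>n. real n ^ 2) \<and>
           (\<forall>n \<ge> 1. \<exists>I :: ('a, 's) sample. valid_sample I \<and> num_answers I = n \<and>
              (\<exists>t q. computes_LGU InS P I t q \<and> T n \<le> q))))"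
proof (intro conjI allI impI)
  obtain Q T where T: "(\<lambda>k. real (T k)) \<in> O(\<lambda>k. real k ^ 2)"
    and score: "\<And>G vs. pair_digraph G \<Longrightarrow> distinct vs \<Longrightarrow> set vs = pverts G \<Longrightarrow>
      \<exists>t s'. exec (\<lambda>_ _ _. False) Q (graph_mem G vs) t 0 s' \<and> t \<le> T (length vs) \<and>
        rmem s' 0 0 = InS G"
    using assms(4) unfolding quadratic_time_score_def by blast
  have "\<exists>t q. computes_LGU InS (lgu_program Q) I t q \<and> t \<le> lgu_time T (num_answers I)"
    for I :: "('a, 's) sample"
    using lgu_program_correct[OF score, of I] unfolding runs_def computes_LGU_def by blast
  with lgu_time_bigo[OF T]
  show "\<exists>P (T :: nat \<Rightarrow> nat). (\<lambda>n. real (T n)) \<in> O(\<lambda>n. real n ^ 2) \<and>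
      (\<forall>I :: ('a, 's) sample. valid_sample I \<longrightarrow>
         (\<exists>t q. computes_LGU InS P I t q \<and> t \<le> T (num_answers I)))"
    by blast
next
  fix P
  assume correct: "\<forall>I :: ('a, 's) sample. valid_sample I \<longrightarrow> (\<exists>t q. computes_LGU InS P I t q)"
  have "\<exists>I :: ('a, 's) sample. valid_sample I \<and> num_answers I = n \<and>
      (\<exists>t q. computes_LGU InS P I t q \<and> ((n - 1) div 2) ^ 2 \<le> q)" if "n \<ge> 1" for n
  proof -
    \<comment> \<open>This choice balances the two factors of \<open>m * (n - m - 1)\<close>: the
      second is at least \<open>m\<close>, so the product is at least \<open>m ^ 2\<close>.\<close>
    let ?m = "(n - 1) div 2"
    have "?m < n" "?m \<le> n - ?m - 1" using that by presburger+
    then have "?m ^ 2 \<le> ?m * (n - ?m - 1)" by (simp add: power2_eq_square)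
    moreover obtain I :: "('a, 's) sample" and t q where
      "valid_sample I" "num_answers I = n" "computes_LGU InS P I t q" "?m * (n - ?m - 1) \<le> q"
      using many_checks[where InS = InS and P = P, OF assms(1-3) _ \<open>?m < n\<close>] correct by blast
    ultimately show ?thesis using le_trans by blast
  qed
  with half_power2_bigomega
  show "\<exists>T :: nat \<Rightarrow> nat. (\<lambda>n. real (T n)) \<in> \<Omega>(\<lambda>n. real n ^ 2) \<and>
      (\<forall>n \<ge> 1. \<exists>I :: ('a, 's) sample. valid_sample I \<and> num_answers I = n \<and>
         (\<exists>t q. computes_LGU InS P I t q \<and> T n \<le> q))"
    by (intro exI[of _ "\<lambda>n. ((n - 1) div 2) ^ 2"] conjI) auto
qed

end
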